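(* Let $B\subset\Omega$ be a solution of $\min_{A\subset\Omega}J(A)$, i.e. $J(B)\le J(A)$ for all measurable $A\subset\Omega$. Then $DJ(B)(x)\ge0$ for almost all $x\in\Omega$.
   Context: Setting: $\Omega\subset\mathbb R^d$ is Lebesgue measurable with $|\Omega|<\infty$ ($|\cdot|$ is Lebesgue measure); all subsets of $\Omega$ considered are Lebesgue measurable. $Y$ is a real Hilbert space, $S:L^2(\Omega)\to Y$ is bounded linear with Hilbert space adjoint $S^*:Y\to L^2(\Omega)$, and $y_d\in Y$. $g:\mathbb R\to\mathbb R\cup\{+\infty\}$ is proper, convex, lower semicontinuous, $g\ge0$, and $g(u)=0$ if and only if $u=0$; with $\operatorname{dom}g=\{u:g(u)<+\infty\}$ there is $\mu>0$ such that $\frac\mu2\lambda(1-\lambda)|u-v|^2+g(\lambda u+(1-\lambda)v)\le\lambda g(u)+(1-\lambda)g(v)$ for all $u,v\in\operatorname{dom}g$, $\lambda\in(0,1)$. There is $q>6$ such that $S^*S$ is a bounded linear map from $L^2(\Omega)$ to $L^q(\Omega)$ and $S^*y_d\in L^q(\Omega)$. $\beta\in L^1(\Omega)$. Notation: for $u\in L^2(\Omega)$ and $A\subset\Omega$, $J(u,A):=\frac12\|S(\chi_Au)-y_d\|_Y^2+\int_\Omega g(u(x))+\chi_A(x)\beta(x)\,dx$, where $\chi_A$ is the characteristic function of $A$, and $J(A):=\min_{u\in L^2(\Omega)}J(u,A)$. Topological derivative: with $B_r(x)$ the open ball of radius $r$ centered at $x$ and $|B_r|$ its measure, $DJ(B)(x):=\lim_{r\searrow0}\frac{J((B\cup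 B_r(x))\cap\Omega)-J(B)}{|B_r|}$ if $x\notin B$, and $DJ(B)(x):=\lim_{r\searrow0}\frac{J(B\setminus B_r(x))-J(B)}{|B_r|}$ if $x\in B$ (this limit exists for almost all $x\in\Omega$). *)

theory Defs
  imports "HOL-Analysis.Analysis"
begin

(* Elements of L^p(M) are represented by functions, not by classes modulo equality a.e.; hence
   an operator with values in L^q is additive and homogeneous only a.e., and the values of these
   functions outside "space M" play no role.  These notions are meant for 1 \<le> p < \<infinity>. *)

definition Lp :: "real \<Rightarrow> 'a measure \<Rightarrow> ('a \<Rightarrow> real) set" where
  "Lp p M = {f \<in> borel_measurable M. integrable M (\<lambda>x. \<bar>f x\<bar> powr p)}"

definition Lp_norm :: "real \<Rightarrow> 'a measure \<Rightarrow> ('a \<Rightarrow> real) \<Rightarrow> real" where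
  "Lp_norm p M f = (\<integral>x. \<bar>f x\<bar> powr p \<partial>M) powr (1 / p)"

(* Boundedness forces T u = T v whenever u = v a.e., so T is well defined on classes. *)
definition bounded_linear_on_Lp ::
  "real \<Rightarrow> 'a measure \<Rightarrow> (('a \<Rightarrow> real) \<Rightarrow> 'b::real_normed_vector) \<Rightarrow> bool" where
  "bounded_linear_on_Lp p M T \<longleftrightarrow>
     (\<forall>u\<in>Lp p M. \<forall>v\<in>Lp p M. T (\<lambda>x. u x + v x) = T u + T v) \<and>
     (\<forall>u\<in>Lp p M. \<forall>c. T (\<lambda>x. c * u x) = c *\<^sub>R T u) \<and>
     (\<exists>C. \<forall>u\<in>Lp p M. norm (T u) \<le> C * Lp_norm p M u)"

definition bounded_linear_Lp_Lq ::
  "real \<Rightarrow> real \<Rightarrow> 'a measure \<Rightarrow> (('a \<Rightarrow> real) \<Rightarrow> 'a \<Rightarrow> real) \<Rightarrow> bool" where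
  "bounded_linear_Lp_Lq p q M T \<longleftrightarrow>
     (\<forall>u\<in>Lp p M. T u \<in> Lp q M) \<and>
     (\<forall>u\<in>Lp p M. \<forall>v\<in>Lp p M. AE x in M. T (\<lambda>x. u x + v x) x = T u x + T v x) \<and>
     (\<forall>u\<in>Lp p M. \<forall>c. AE x in M. T (\<lambda>x. c * u x) x = c * T u x) \<and>
     (\<exists>C. \<forall>u\<in>Lp p M. Lp_norm q M (T u) \<le> C * Lp_norm p M u)"

definition is_L2_adjoint ::
  "'a measure \<Rightarrow> (('a \<Rightarrow> real) \<Rightarrow> 'y::real_inner) \<Rightarrow> ('y \<Rightarrow> 'a \<Rightarrow> real) \<Rightarrow> bool" where
  "is_L2_adjoint M S S' \<longleftrightarrow>
     (\<forall>y. S' y \<in> Lp 2 M) \<and>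
     (\<forall>u\<in>Lp 2 M. \<forall>y. inner (S u) y = (\<integral>x. u x * S' y x \<partial>M))"

definition edom :: "(real \<Rightarrow> ereal) \<Rightarrow> real set" where
  "edom g = {u. g u < \<infinity>}"

definition proper_fun :: "(real \<Rightarrow> ereal) \<Rightarrow> bool" where
  "proper_fun g \<longleftrightarrow> (\<forall>u. g u \<noteq> -\<infinity>) \<and> edom g \<noteq> {}"

definition econvex :: "(real \<Rightarrow> ereal) \<Rightarrow> bool" where
  "econvex g \<longleftrightarrow> (\<forall>u v. \<forall>t\<in>{0<..<1}.
     g (t * u + (1 - t) * v) \<le> ereal t * g u + ereal (1 - t) * g v)"

definition lower_semicont :: "(real \<Rightarrow> ereal) \<Rightarrow> bool" where
  "lower_semicont g \<longleftrightarrow> (\<forall>u. g u \<le> Liminf (at u) g)"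

(* Integral of the positive part minus integral of the negative part (e2ennreal sends negative
   numbers to 0).  Below, the negative part always has finite integral. *)
definition ext_integral :: "'a measure \<Rightarrow> ('a \<Rightarrow> ereal) \<Rightarrow> ereal" where
  "ext_integral M f =
     enn2ereal (\<integral>\<^sup>+x. e2ennreal (f x) \<partial>M) - enn2ereal (\<integral>\<^sup>+x. e2ennreal (- f x) \<partial>M)"

definition J_cost ::
  "'a::euclidean_space set \<Rightarrow> (('a \<Rightarrow> real) \<Rightarrow> 'y::real_inner) \<Rightarrow> 'y \<Rightarrow> (real \<Rightarrow> ereal) \<Rightarrow>
   ('a \<Rightarrow> real) \<Rightarrow> ('a \<Rightarrow> real) \<Rightarrow> 'a set \<Rightarrow> ereal" where
  "J_cost \<Omega> S y\<^sub>d g \<beta> u A =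
     ereal (1 / 2 * (norm (S (\<lambda>x. indicator A x * u x) - y\<^sub>d))\<^sup>2)
     + ext_integral (lebesgue_on \<Omega>) (\<lambda>x. g (u x) + ereal (indicator A x * \<beta> x))"

(* LEAST is the attained minimum; it is unspecified where no minimizer exists. *)
definition J_min ::
  "'a::euclidean_space set \<Rightarrow> (('a \<Rightarrow> real) \<Rightarrow> 'y::real_inner) \<Rightarrow> 'y \<Rightarrow> (real \<Rightarrow> ereal) \<Rightarrow>
   ('a \<Rightarrow> real) \<Rightarrow> 'a set \<Rightarrow> ereal" where
  "J_min \<Omega> S y\<^sub>d g \<beta> A =
     (LEAST m. \<exists>u\<in>Lp 2 (lebesgue_on \<Omega>). m = J_cost \<Omega> S y\<^sub>d g \<beta> u A)"

definition DJ_quotient ::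
  "'a::euclidean_space set \<Rightarrow> (('a \<Rightarrow> real) \<Rightarrow> 'y::real_inner) \<Rightarrow> 'y \<Rightarrow> (real \<Rightarrow> ereal) \<Rightarrow>
   ('a \<Rightarrow> real) \<Rightarrow> 'a set \<Rightarrow> 'a \<Rightarrow> real \<Rightarrow> ereal" where
  "DJ_quotient \<Omega> S y\<^sub>d g \<beta> B x r =
     (J_min \<Omega> S y\<^sub>d g \<beta> (if x \<in> B then B - ball x r else (B \<union> ball x r) \<inter> \<Omega>)
        - J_min \<Omega> S y\<^sub>d g \<beta> B)
     / ereal (measure lebesgue (ball x r))"

definition DJ_exists ::
  "'a::euclidean_space set \<Rightarrow> (('a \<Rightarrow> real) \<Rightarrow> 'y::real_inner) \<Rightarrow> 'y \<Rightarrow> (real \<Rightarrow> ereal) \<Rightarrow>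
   ('a \<Rightarrow> real) \<Rightarrow> 'a set \<Rightarrow> 'a \<Rightarrow> bool" where
  "DJ_exists \<Omega> S y\<^sub>d g \<beta> B x \<longleftrightarrow>
     (\<exists>l::real. (DJ_quotient \<Omega> S y\<^sub>d g \<beta> B x \<longlongrightarrow> ereal l) (at_right 0))"

(* Meaningful only where DJ_exists holds. *)
definition DJ ::
  "'a::euclidean_space set \<Rightarrow> (('a \<Rightarrow> real) \<Rightarrow> 'y::real_inner) \<Rightarrow> 'y \<Rightarrow> (real \<Rightarrow> ereal) \<Rightarrow>
   ('a \<Rightarrow> real) \<Rightarrow> 'a set \<Rightarrow> 'a \<Rightarrow> ereal" where
  "DJ \<Omega> S y\<^sub>d g \<beta> B x = Lim (at_right 0) (DJ_quotient \<Omega> S y\<^sub>d g \<beta> B x)"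

end

theory Submission
  imports Defs
begin

text \<open>The minimal cost of a set \<open>A\<close> is expanded to first order around a fixed set \<open>B\<close>, with an explicit
  bound for the remainder. Let \<open>a\<close> be the optimal state of \<open>B\<close> minus the target, \<open>p = S_adj a\<close> the adjoint
  state, \<open>w x\<close> the unique minimizer of \<open>u \<mapsto> u * p x + g u\<close>, and \<open>F = w * p + g w + \<beta>\<close>. The first-order
  optimality conditions say that the optimal control of \<open>B\<close> is \<open>w\<close> restricted to \<open>B\<close>. Linearizing the
  quadratic term at \<open>a\<close> gives, for all measurable \<open>A\<close>, that \<open>J A - J B\<close> is at least the integral of \<open>F\<close>
  over \<open>A\<close> minus that over \<open>B\<close>; testing the problem on \<open>A\<close> with the restriction of \<open>w\<close> gives the same
  quantity plus half the squared norm of \<open>S\<close> applied to the difference of the two restrictions as an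
  upper bound (\<open>min_cost_first_order_expansion\<close>).

  If \<open>A\<close> differs from \<open>B\<close> by part of a small ball \<open>D\<close>, then, for almost every centre, this squared norm
  is of smaller order than the measure of \<open>D\<close>: the mean square of \<open>w\<close> over \<open>D\<close> stays bounded, and
  \<open>S\<^sup>*S\<close> maps \<open>L\<^sup>2\<close> boundedly into \<open>L\<^sup>q\<close> with \<open>q > 2\<close> (\<open>norm_S_localized_small\<close>). By the Lebesgue differentiation theorem for balls
  (\<open>lebesgue_differentiation_balls\<close>) the difference quotients therefore converge almost everywhere, to
  \<open>F x\<close> outside \<open>B\<close> and to \<open>- F x\<close> inside \<open>B\<close>. If \<open>B\<close> is optimal, then all difference quotients are
  nonnegative, and so is their limit.

  Minimizers exist because strong convexity makes minimizing sequences Cauchy in \<open>L\<^sup>2\<close>, which is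
  complete (\<open>L2_complete\<close>, \<open>ex_minimizer\<close>).\<close>

section \<open>Lebesgue differentiation along balls\<close>

text \<open>The part of an integrable function above a high level carries little mass. Splitting a function
  at such a level turns a bound on the measure of a set into a bound on the integral over it.\<close>

lemma integral_excess_small:
  fixes \<phi> :: "'a \<Rightarrow> real"
  assumes \<phi>: "integrable M \<phi>" and "0 < \<delta>"
  obtains k :: nat where "(\<integral>x. max 0 (\<phi> x - real k) \<partial>M) < \<delta>"
proof -
  have [measurable]: "\<phi> \<in> borel_measurable M" using \<phi> by auto
  have "(\<lambda>k. \<integral>x. max 0 (\<phi> x - real k) \<partial>M) \<longlonglongrightarrow> (\<integral>x. 0 \<partial>M)"
  proof (rule integral_dominated_convergence[where w="\<lambda>x. \<bar>\<phi> x\<bar>"])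
    show "AE x in M. (\<lambda>k. max 0 (\<phi> x - real k)) \<longlonglongrightarrow> 0"
    proof (intro AE_I2)
      fix x
      have "eventually (\<lambda>k. real k \<ge> \<phi> x) sequentially"
        using filterlim_real_sequentially by (simp add: filterlim_at_top)
      hence "eventually (\<lambda>k. max 0 (\<phi> x - real k) = 0) sequentially"
        by eventually_elim simp
      thus "(\<lambda>k. max 0 (\<phi> x - real k)) \<longlonglongrightarrow> 0"
        by (rule tendsto_eventually)
    qed
  qed (use \<phi> in auto)
  hence "eventually (\<lambda>k. (\<integral>x. max 0 (\<phi> x - real k) \<partial>M) < \<delta>) sequentially"
    using order_tendstoD(2)[of _ 0 sequentially \<delta>] \<open>0 < \<delta>\<close> by simp
  thus ?thesis using that by (auto simp: eventually_sequentially)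
qed

text \<open>Outer regularity makes the measure of \<open>U\<close> minus the zero set small; the function lives on this
  difference only, so that after truncation at a level \<open>k\<close> its integral over \<open>U\<close> is small as well.\<close>

lemma open_superset_of_zero_set_small_integral:
  fixes \<phi> :: "'a::euclidean_space \<Rightarrow> real"
  assumes \<phi>: "integrable lebesgue \<phi>" and nonneg: "\<And>x. 0 \<le> \<phi> x" and "0 < \<delta>"
  obtains U where "open U" "{x. \<phi> x = 0} \<subseteq> U" "(\<integral>x. indicator U x * \<phi> x \<partial>lebesgue) < \<delta>"
proof -
  have [measurable]: "\<phi> \<in> borel_measurable lebesgue" using \<phi> by auto
  define P where "P = {x. \<phi> x = 0}"
  have P: "P \<in> sets lebesgue"
    unfolding P_def using measurable_sets[OF \<open>\<phi> \<in> borel_measurable lebesgue\<close>, of "{0}"]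
    by (simp add: vimage_def)
  obtain k where k: "(\<integral>x. max 0 (\<phi> x - real k) \<partial>lebesgue) < \<delta>/2"
    using integral_excess_small[OF \<phi>, of "\<delta>/2"] \<open>0 < \<delta>\<close> by auto
  have "0 < \<delta> / (2 * (real k + 1))" using \<open>0 < \<delta>\<close> by simp
  then obtain U where U: "open U" "P \<subseteq> U" "U - P \<in> lmeasurable"
      "emeasure lebesgue (U - P) < ennreal (\<delta> / (2 * (real k + 1)))"
    using sets_lebesgue_outer_open[OF P] by metis
  have mU: "measure lebesgue (U - P) < \<delta> / (2 * (real k + 1))"
    using U(3,4) \<open>0 < \<delta>\<close> by (simp add: emeasure_eq_measure2 ennreal_less_iff)
  have intx: "integrable lebesgue (\<lambda>x. max 0 (\<phi> x - real k))"
    by (rule Bochner_Integration.integrable_bound[OF \<phi>]) (use nonneg in auto)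
  have intU: "integrable lebesgue (indicat_real (U - P))"
    using U(3) by (intro integrable_real_indicator) (auto simp: fmeasurable_def)
  have "(\<integral>x. indicator U x * \<phi> x \<partial>lebesgue) \<le>
        (\<integral>x. max 0 (\<phi> x - real k) + real k * indicator (U - P) x \<partial>lebesgue)"
  proof (rule integral_mono_AE')
    show "AE x in lebesgue. indicator U x * \<phi> x \<le> max 0 (\<phi> x - real k) + real k * indicator (U - P) x"
      by (auto simp: indicator_def P_def)
  qed (use intx intU nonneg in auto)
  also have "\<dots> = (\<integral>x. max 0 (\<phi> x - real k) \<partial>lebesgue) + real k * measure lebesgue (U - P)"
    using intx intU by simp
  also have "\<dots> < \<delta>"
  proof -
    have "real k * measure lebesgue (U - P) \<le> (real k + 1) * measure lebesgue (U - P)"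
      by (simp add: mult_right_mono)
    also have "\<dots> \<le> (real k + 1) * (\<delta> / (2 * (real k + 1)))"
      using mU by (intro mult_left_mono) auto
    also have "\<dots> = \<delta>/2" by (simp add: field_simps)
    finally show ?thesis using k by simp
  qed
  finally show ?thesis using that U P_def by blast
qed

text \<open>The balls with a large average that lie in a given open \<open>U\<close> around the zero set form a Vitali
  cover of the exceptional set. A disjoint subfamily exhausts it up to a null set, and on each of
  its balls the integral of \<open>\<phi>\<close> is at least \<open>e\<close> times the volume. Summing up, the exceptional set has
  outer measure at most \<open>1 / e\<close> times the integral of \<open>\<phi>\<close> over \<open>U\<close>, which is arbitrarily small.\<close>

lemma negligible_large_averages:
  fixes \<phi> :: "'a::euclidean_space \<Rightarrow> real"
  assumes \<phi>: "integrable lebesgue \<phi>" and nonneg: "\<And>x. 0 \<le> \<phi> x" and e: "0 < e"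
  shows "negligible {x. \<phi> x = 0 \<and> (\<forall>d>0. \<exists>r. 0 < r \<and> r < d \<and>
            e * measure lebesgue (ball x r) < (\<integral>y. indicator (ball x r) y * \<phi> y \<partial>lebesgue))}"
    (is "negligible ?E")
  unfolding negligible_outer_le
proof (intro allI impI)
  fix \<delta> :: real assume "0 < \<delta>"
  have [measurable]: "\<phi> \<in> borel_measurable lebesgue" using \<phi> by auto
  obtain U where U: "open U" "{x. \<phi> x = 0} \<subseteq> U"
      "(\<integral>x. indicator U x * \<phi> x \<partial>lebesgue) < e * \<delta>"
    using open_superset_of_zero_set_small_integral[OF \<phi> nonneg, of "e * \<delta>"] e \<open>0 < \<delta>\<close> by auto
  define \<nu> where "\<nu> = density lebesgue (\<lambda>x. ennreal (\<phi> x))"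
  have sets\<nu> [simp]: "sets \<nu> = sets lebesgue" by (simp add: \<nu>_def)
  have ib: "integrable lebesgue (\<lambda>x. indicator A x * \<phi> x)" if "A \<in> sets lebesgue" for A
    using integrable_mult_indicator[OF that \<phi>] by simp
  have \<nu>: "emeasure \<nu> A = ennreal (\<integral>x. indicator A x * \<phi> x \<partial>lebesgue)"
    if "A \<in> sets lebesgue" for A
  proof -
    have "emeasure \<nu> A = (\<integral>\<^sup>+x. ennreal (indicator A x * \<phi> x) \<partial>lebesgue)"
      unfolding \<nu>_def using that
      by (subst emeasure_density) (auto intro!: nn_integral_cong simp: indicator_def)
    also have "\<dots> = ennreal (\<integral>x. indicator A x * \<phi> x \<partial>lebesgue)"
      using ib[OF that] nonneg by (intro nn_integral_eq_integral) auto
    finally show ?thesis .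
  qed
  define K where "K = {(x, r). 0 < r \<and> ball x r \<subseteq> U \<and>
      e * measure lebesgue (ball x r) < (\<integral>y. indicator (ball x r) y * \<phi> y \<partial>lebesgue)}"
  have "\<exists>i. i \<in> K \<and> x \<in> ball (fst i) (snd i) \<and> snd i < d" if "x \<in> ?E" "0 < d" for x d
  proof -
    have "x \<in> U" using U(2) that(1) by auto
    with U(1) obtain d0 where d0: "0 < d0" "ball x d0 \<subseteq> U" by (meson openE)
    have "0 < min d d0" using that(2) d0 by simp
    then obtain r where r: "0 < r" "r < min d d0"
        "e * measure lebesgue (ball x r) < (\<integral>y. indicator (ball x r) y * \<phi> y \<partial>lebesgue)"
      using \<open>x \<in> ?E\<close> by blast
    have "ball x r \<subseteq> ball x d0" using r by (intro subset_ball) auto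
    with d0 have "ball x r \<subseteq> U" by blast
    thus ?thesis using r by (intro exI[of _ "(x, r)"]) (auto simp: K_def)
  qed
  then obtain C where C: "countable C" "C \<subseteq> K"
     "pairwise (\<lambda>i j. disjnt (ball (fst i) (snd i)) (ball (fst j) (snd j))) C"
     "negligible (?E - (\<Union>i \<in> C. ball (fst i) (snd i)))"
    using Vitali_covering_theorem_balls[of ?E K fst snd] by blast
  define T where "T = (\<Union>i\<in>C. ball (fst i) (snd i))"
  have CK: "ball (fst i) (snd i) \<subseteq> U \<and> e * measure lebesgue (ball (fst i) (snd i))
        \<le> (\<integral>y. indicator (ball (fst i) (snd i)) y * \<phi> y \<partial>lebesgue)" if "i \<in> C" for i
  proof -
    have "i \<in> K" using that C(2) by blast
    thus ?thesis by (simp add: K_def case_prod_beta)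
  qed
  have TU: "T \<subseteq> U" using CK unfolding T_def by blast
  have opT: "open T" unfolding T_def by auto
  have T: "T \<in> sets lebesgue" "U \<in> sets lebesgue" using opT U(1) by auto
  have disj: "disjoint_family_on (\<lambda>i. ball (fst i) (snd i)) C"
    using C(3) by (auto simp: disjoint_family_on_def pairwise_def disjnt_def)
  have "ennreal e * emeasure lebesgue T =
        (\<integral>\<^sup>+i. ennreal e * emeasure lebesgue (ball (fst i) (snd i)) \<partial>count_space C)"
    unfolding T_def using C(1) disj
    by (subst emeasure_UN_countable) (auto simp: nn_integral_cmult)
  also have "\<dots> \<le> (\<integral>\<^sup>+i. emeasure \<nu> (ball (fst i) (snd i)) \<partial>count_space C)"
  proof (rule nn_integral_mono)
    fix i assume "i \<in> space (count_space C)"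
    hence "e * measure lebesgue (ball (fst i) (snd i))
        \<le> (\<integral>y. indicator (ball (fst i) (snd i)) y * \<phi> y \<partial>lebesgue)"
      using CK by simp
    moreover have "emeasure lebesgue (ball (fst i) (snd i)) = ennreal (measure lebesgue (ball (fst i) (snd i)))"
      by (intro emeasure_eq_measure2) auto
    ultimately show "ennreal e * emeasure lebesgue (ball (fst i) (snd i)) \<le> emeasure \<nu> (ball (fst i) (snd i))"
      using e by (simp add: \<nu> flip: ennreal_mult) (simp add: ennreal_leI)
  qed
  also have "\<dots> = emeasure \<nu> T"
    unfolding T_def using C(1) disj by (subst emeasure_UN_countable) auto
  also have "\<dots> \<le> emeasure \<nu> U" using TU T by (intro emeasure_mono) auto
  also have "\<dots> < ennreal (e * \<delta>)"
    using U(3) \<nu>[OF T(2)] e \<open>0 < \<delta>\<close> by (simp add: ennreal_less_iff nonneg)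
  finally have eT: "ennreal e * emeasure lebesgue T < ennreal e * ennreal \<delta>"
    using e \<open>0 < \<delta>\<close> by (simp add: ennreal_mult)
  hence "emeasure lebesgue T < ennreal \<delta>"
    by (metis e ennreal_mult_strict_left_mono ennreal_less_top mult_left_mono not_le zero_le)
  hence lmT: "T \<in> lmeasurable" and mT: "measure lebesgue T \<le> \<delta>"
    using T(1) \<open>0 < \<delta>\<close>
    by (auto simp: fmeasurable_def less_top[symmetric] measure_def enn2real_leI intro: less_trans)
  let ?N = "?E - T"
  have N: "negligible ?N" using C(4) by (simp add: T_def)
  show "\<exists>T. ?E \<subseteq> T \<and> T \<in> lmeasurable \<and> measure lebesgue T \<le> \<delta>"
  proof (intro exI[of _ "T \<union> ?N"] conjI)
    show "T \<union> ?N \<in> lmeasurable" using lmT negligible_imp_measurable[OF N] by (rule fmeasurable.Un)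
    have "measure lebesgue (T \<union> ?N) \<le> measure lebesgue T + measure lebesgue ?N"
      using lmT N by (intro measure_Un_le) (auto simp: negligible_imp_sets)
    thus "measure lebesgue (T \<union> ?N) \<le> \<delta>" using N mT by (simp add: negligible_imp_measure0)
  qed auto
qed

definition ball_average :: "('a::euclidean_space \<Rightarrow> real) \<Rightarrow> 'a \<Rightarrow> real \<Rightarrow> real" where
  "ball_average f x r = (\<integral>y. indicator (ball x r) y * f y \<partial>lebesgue) / measure lebesgue (ball x r)"

lemma AE_ball_average_tendsto_0_on_zero_set:
  fixes \<phi> :: "'a::euclidean_space \<Rightarrow> real"
  assumes \<phi>: "integrable lebesgue \<phi>" and nonneg: "\<And>x. 0 \<le> \<phi> x"
  shows "AE x in lebesgue. \<phi> x = 0 \<longrightarrow> (ball_average \<phi> x \<longlongrightarrow> 0) (at_right 0)"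
proof -
  have "AE x in lebesgue. \<forall>n. \<not> (\<phi> x = 0 \<and> (\<forall>d>0. \<exists>r. 0 < r \<and> r < d \<and>
      1 / Suc n * measure lebesgue (ball x r) < (\<integral>y. indicator (ball x r) y * \<phi> y \<partial>lebesgue)))"
    unfolding AE_all_countable
  proof
    fix n :: nat
    show "AE x in lebesgue. \<not> (\<phi> x = 0 \<and> (\<forall>d>0. \<exists>r. 0 < r \<and> r < d \<and>
      1 / Suc n * measure lebesgue (ball x r) < (\<integral>y. indicator (ball x r) y * \<phi> y \<partial>lebesgue)))"
      using AE_not_in[OF negligible_large_averages[OF \<phi> nonneg, of "1 / Suc n",
            unfolded negligible_iff_null_sets]] by simp
  qed
  thus ?thesis
  proof (eventually_elim, intro impI tendstoI)
    fix x and \<epsilon> :: real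
    assume *: "\<forall>n. \<not> (\<phi> x = 0 \<and> (\<forall>d>0. \<exists>r. 0 < r \<and> r < d \<and>
      1 / Suc n * measure lebesgue (ball x r) < (\<integral>y. indicator (ball x r) y * \<phi> y \<partial>lebesgue)))"
      and "\<phi> x = 0" and "0 < \<epsilon>"
    obtain n :: nat where n: "1 / Suc n < \<epsilon>" using \<open>0 < \<epsilon>\<close> nat_approx_posE by blast
    obtain d where d: "0 < d" "\<And>r. 0 < r \<Longrightarrow> r < d \<Longrightarrow>
       (\<integral>y. indicator (ball x r) y * \<phi> y \<partial>lebesgue) \<le> 1 / Suc n * measure lebesgue (ball x r)"
      using *[rule_format, of n] \<open>\<phi> x = 0\<close> by (meson not_less)
    show "eventually (\<lambda>r. dist (ball_average \<phi> x r) 0 < \<epsilon>) (at_right 0)"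
      unfolding eventually_at_right_field
    proof (intro exI[of _ d] conjI allI impI)
      fix r assume r: "0 < r" "r < d"
      have "0 \<le> ball_average \<phi> x r" using nonneg by (auto simp: ball_average_def)
      moreover have "ball_average \<phi> x r \<le> 1 / Suc n"
        using d(2)[OF r] r(1) content_ball_pos[OF r(1), of x] by (simp add: ball_average_def divide_simps)
      ultimately show "dist (ball_average \<phi> x r) 0 < \<epsilon>" using n by (simp add: dist_real_def)
    qed (fact d(1))
  qed
qed

text \<open>For rational \<open>c\<close> near \<open>f x\<close> on the upper (lower) side, the positive part of \<open>f - c\<close> (of \<open>c - f\<close>)
  vanishes at \<open>x\<close>, so that its averages tend to 0 for almost every such \<open>x\<close>, and \<open>f\<close> exceeds \<open>c\<close>
  (falls below \<open>c\<close>) on average by no more than that.\<close>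

theorem lebesgue_differentiation_balls:
  fixes f :: "'a::euclidean_space \<Rightarrow> real"
  assumes f: "integrable lebesgue f"
  shows "AE x in lebesgue. (ball_average f x \<longlongrightarrow> f x) (at_right 0)"
proof -
  \<comment> \<open>The sign \<open>s\<close> selects the side; the cut-off to a ball makes the positive part integrable,
      and the limit at \<open>x\<close> does not feel it as soon as \<open>norm x < N\<close>.\<close>
  define \<phi> where "\<phi> s N c = (\<lambda>x. indicator (ball 0 (real N)) x * max 0 (s * (f x - c)))"
    for s c :: real and N :: nat
  have [measurable]: "f \<in> borel_measurable lebesgue" using f by auto
  have [measurable]: "ball z r \<in> sets lebesgue" for z :: 'a and r by simp
  have ib: "integrable lebesgue (\<lambda>x. indicator A x * h x)"
    if "A \<in> sets lebesgue" "integrable lebesgue h" for A and h :: "'a \<Rightarrow> real"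
    using integrable_mult_indicator[OF that] by simp
  have ball: "integrable lebesgue (indicat_real (ball z r))" for z :: 'a and r
    using lmeasurable_ball[of z r] by (intro integrable_real_indicator) (auto simp: fmeasurable_def)
  have int\<phi>: "integrable lebesgue (\<phi> s N c)" for s N c
  proof -
    have "integrable lebesgue (\<lambda>x. \<bar>s\<bar> * (\<bar>f x\<bar> + \<bar>c\<bar> * indicator (ball 0 (real N)) x))"
      using f ball by auto
    thus ?thesis
    proof (rule Bochner_Integration.integrable_bound)
      have "max 0 (s * (f x - c)) \<le> \<bar>s\<bar> * (\<bar>f x\<bar> + \<bar>c\<bar>)" for x
      proof -
        have "s * (f x - c) \<le> \<bar>s\<bar> * \<bar>f x - c\<bar>" by (metis abs_ge_self abs_mult)
        also have "\<dots> \<le> \<bar>s\<bar> * (\<bar>f x\<bar> + \<bar>c\<bar>)" by (intro mult_left_mono) auto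
        finally show ?thesis by simp
      qed
      thus "AE x in lebesgue. norm (\<phi> s N c x)
          \<le> norm (\<bar>s\<bar> * (\<bar>f x\<bar> + \<bar>c\<bar> * indicator (ball 0 (real N)) x))"
        by (intro AE_I2) (simp add: \<phi>_def indicator_def)
    qed (simp add: \<phi>_def)
  qed
  have "AE x in lebesgue. \<forall>s\<in>{1,-1}. \<forall>N. \<forall>c\<in>\<rat>.
      \<phi> s N c x = 0 \<longrightarrow> (ball_average (\<phi> s N c) x \<longlongrightarrow> 0) (at_right 0)"
    by (intro AE_ball_countable' AE_all_countable[THEN iffD2] allI
          AE_ball_average_tendsto_0_on_zero_set[OF int\<phi>])
      (simp_all add: \<phi>_def countable_rat)
  thus ?thesis
  proof eventually_elim
    fix x
    assume *: "\<forall>s\<in>{1,-1}. \<forall>N. \<forall>c\<in>\<rat>.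
      \<phi> s N c x = 0 \<longrightarrow> (ball_average (\<phi> s N c) x \<longlongrightarrow> 0) (at_right 0)"
    have one_sided: "eventually (\<lambda>r. s * (ball_average f x r - f x) < \<epsilon>) (at_right 0)"
      if s: "s \<in> {1,-1}" and "0 < \<epsilon>" for s \<epsilon> :: real
    proof -
      have "\<exists>c\<in>\<rat>. 0 < s * (c - f x) \<and> s * (c - f x) < \<epsilon>/2"
        using Rats_dense_in_real[of "f x" "f x + \<epsilon>/2"] Rats_dense_in_real[of "f x - \<epsilon>/2" "f x"]
          s \<open>0 < \<epsilon>\<close> by (elim insertE) (fastforce simp: algebra_simps)+
      then obtain c where c: "c \<in> \<rat>" "0 < s * (c - f x)" "s * (c - f x) < \<epsilon>/2" by blast
      obtain N :: nat where N: "norm x < real N" using reals_Archimedean2 by blast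
      have "s * (f x - c) \<le> 0" using c(2) by (simp add: algebra_simps)
      hence "\<phi> s N c x = 0" by (simp add: \<phi>_def)
      hence "(ball_average (\<phi> s N c) x \<longlongrightarrow> 0) (at_right 0)" using * s c by blast
      hence "eventually (\<lambda>r. ball_average (\<phi> s N c) x r < \<epsilon>/2) (at_right 0)"
        using order_tendstoD(2)[of _ 0 _ "\<epsilon>/2"] \<open>0 < \<epsilon>\<close> by simp
      moreover have "eventually (\<lambda>r. 0 < r \<and> r < N - norm x) (at_right (0::real))"
        using N by (auto simp: eventually_at_right_field intro!: exI[of _ "N - norm x"])
      ultimately show ?thesis
      proof eventually_elim
        case (elim r)
        let ?m = "measure lebesgue (ball x r)"
        have m: "0 < ?m" using elim by (simp add: content_ball_pos)
        have sub: "ball x r \<subseteq> ball 0 (real N)"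
        proof
          fix y assume "y \<in> ball x r"
          thus "y \<in> ball 0 (real N)" using elim norm_triangle_ineq4[of x "x - y"]
            by (simp add: dist_norm)
        qed
        have "s * (\<integral>y. indicator (ball x r) y * f y \<partial>lebesgue) - s * c * ?m
           = (\<integral>y. s * (indicator (ball x r) y * f y) - s * c * indicator (ball x r) y \<partial>lebesgue)"
          using ib[OF _ f, of "ball x r"] ball[of x r] by simp
        also have "\<dots> \<le> (\<integral>y. indicator (ball x r) y * \<phi> s N c y \<partial>lebesgue)"
        proof (rule integral_mono)
          fix y
          show "s * (indicator (ball x r) y * f y) - s * c * indicator (ball x r) y
              \<le> indicator (ball x r) y * \<phi> s N c y"
            using sub by (auto simp: indicator_def \<phi>_def algebra_simps)
        qed (use ib[OF _ f, of "ball x r"] ball[of x r] ib[OF _ int\<phi>, of "ball x r"] in auto)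
        finally have "s * ball_average f x r - s * c \<le> ball_average (\<phi> s N c) x r"
          using m by (simp add: ball_average_def divide_simps mult.commute mult.left_commute)
        thus ?case using elim c(3) by (simp add: algebra_simps)
      qed
    qed
    show "(ball_average f x \<longlongrightarrow> f x) (at_right 0)"
    proof (rule tendstoI)
      fix \<epsilon> :: real assume "0 < \<epsilon>"
      from one_sided[of 1 \<epsilon>] one_sided[of "-1" \<epsilon>] \<open>0 < \<epsilon>\<close>
      show "eventually (\<lambda>r. dist (ball_average f x r) (f x) < \<epsilon>) (at_right 0)"
        by (auto simp: dist_real_def elim: eventually_elim2)
    qed
  qed
qed

section \<open>Pointwise minimization of a strongly convex integrand\<close>

text \<open>The integrand of the control cost. The pointwise optimality condition of the control problem asks
  for the minimizer of \<open>u \<mapsto> s * u + g u\<close>, where \<open>s\<close> is the value of the adjoint state. Strong convexity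
  makes this minimizer unique and Lipschitz continuous in \<open>s\<close>.\<close>

locale strongly_convex_integrand =
  fixes g :: "real \<Rightarrow> ereal" and \<mu> :: real
  assumes g_lsc: "lower_semicont g"
    and g_nonneg: "\<And>u. 0 \<le> g u"
    and g_zero_iff: "\<And>u. g u = 0 \<longleftrightarrow> u = 0"
    and mu_pos: "0 < \<mu>"
    and g_strongly_convex:
      "\<And>u v t. u \<in> edom g \<Longrightarrow> v \<in> edom g \<Longrightarrow> t \<in> {0<..<1} \<Longrightarrow>
         ereal (\<mu> / 2 * t * (1 - t) * \<bar>u - v\<bar>\<^sup>2) + g (t * u + (1 - t) * v)
           \<le> ereal t * g u + ereal (1 - t) * g v"
begin

lemma g_0 [simp]: "g 0 = 0"
  using g_zero_iff by simp

lemma g_sequentially_lsc: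
  assumes "X \<longlonglongrightarrow> u"
  shows "g u \<le> liminf (\<lambda>n. g (X n))"
proof (rule le_Liminf_iff[THEN iffD2], intro allI impI)
  fix c assume "c < g u"
  with g_lsc have "eventually (\<lambda>v. c < g v) (at u)"
    unfolding lower_semicont_def le_Liminf_iff by blast
  with \<open>c < g u\<close> have "eventually (\<lambda>v. c < g v) (nhds u)"
    by (auto simp: eventually_nhds_conv_at)
  thus "eventually (\<lambda>n. c < g (X n)) sequentially"
    using assms by (auto simp: filterlim_iff)
qed

lemma borel_measurable_g [measurable]: "g \<in> borel_measurable borel"
proof (rule borel_measurableI_le)
  fix c
  have "closed {u. g u \<le> c}"
    unfolding closed_sequential_limits
  proof (intro allI impI, elim conjE)
    fix X u assume X: "\<forall>n. X n \<in> {u. g u \<le> c}" and "X \<longlonglongrightarrow> u"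
    have "g u \<le> liminf (\<lambda>n. g (X n))" by (rule g_sequentially_lsc) fact
    also have "\<dots> \<le> liminf (\<lambda>n. c)" using X by (intro Liminf_mono) auto
    finally show "u \<in> {u. g u \<le> c}" by (simp add: Liminf_const)
  qed
  thus "{x \<in> space borel. g x \<le> c} \<in> sets borel" by simp
qed

text \<open>The finite values of \<open>g\<close>; off \<open>edom g\<close> this is the default value 0, so it is used only together
  with membership in \<open>edom g\<close>.\<close>

definition gr :: "real \<Rightarrow> real" where "gr u = real_of_ereal (g u)"

lemma gr_0 [simp]: "gr 0 = 0"
  by (simp add: gr_def)

lemma measurable_gr [measurable]: "gr \<in> borel_measurable borel"
  unfolding gr_def by measurable

lemma gr_nonneg: "0 \<le> gr u"
  using g_nonneg[of u] by (simp add: gr_def real_of_ereal_pos)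

lemma edom_iff: "u \<in> edom g \<longleftrightarrow> g u = ereal (gr u)"
  using g_nonneg[of u] by (cases "g u") (auto simp: edom_def gr_def)

lemma zero_in_edom [simp]: "0 \<in> edom g"
  by (simp add: edom_def)

lemma gr_strongly_convex:
  assumes "u \<in> edom g" "v \<in> edom g" "0 < t" "t < 1"
  shows "t * u + (1 - t) * v \<in> edom g"
    "\<mu> / 2 * t * (1 - t) * (u - v)\<^sup>2 + gr (t * u + (1 - t) * v) \<le> t * gr u + (1 - t) * gr v"
proof -
  have eq: "g u = ereal (gr u)" "g v = ereal (gr v)" using assms edom_iff by blast+
  have *: "ereal (\<mu> / 2 * t * (1 - t) * (u - v)\<^sup>2) + g (t * u + (1 - t) * v)
      \<le> ereal (t * gr u + (1 - t) * gr v)"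
    using g_strongly_convex[of u v t] assms eq by
      (metis greaterThanLessThan_iff plus_ereal.simps(1) power2_abs times_ereal.simps(1))
  have "0 \<le> g (t * u + (1 - t) * v)" by (rule g_nonneg)
  with * show "t * u + (1 - t) * v \<in> edom g"
    "\<mu> / 2 * t * (1 - t) * (u - v)\<^sup>2 + gr (t * u + (1 - t) * v) \<le> t * gr u + (1 - t) * gr v"
    by (cases "g (t * u + (1 - t) * v)"; auto simp: edom_def gr_def)+
qed

text \<open>By strong convexity at midpoints, a minimizing sequence is Cauchy; semicontinuity of \<open>g\<close> makes its
  limit a minimizer.\<close>

lemma ex_minimizer_tilted:
  "\<exists>w\<in>edom g. \<forall>u\<in>edom g. w * s + gr w \<le> u * s + gr u"
proof -
  \<comment> \<open>Strong convexity between \<open>u\<close> and the minimum point 0 gives quadratic growth, hence the tilted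
      function is bounded below.\<close>
  have g_ge: "\<mu> / 4 * u\<^sup>2 \<le> gr u" if "u \<in> edom g" for u
  proof -
    have "\<mu> / 8 * u\<^sup>2 \<le> \<mu> / 8 * u\<^sup>2 + gr (u / 2)" using gr_nonneg[of "u / 2"] by simp
    also have "\<dots> \<le> gr u / 2"
      using gr_strongly_convex(2)[OF that zero_in_edom, of "1/2"] by simp
    finally show ?thesis by simp
  qed
  define F where "F u = u * s + gr u" for u
  define m where "m = Inf (F ` edom g)"
  have low: "- s\<^sup>2 / \<mu> \<le> F u" if "u \<in> edom g" for u
  proof -
    have "0 \<le> \<mu> / 4 * (u + 2 * s / \<mu>)\<^sup>2" using mu_pos by simp
    also have "\<dots> = \<mu> / 4 * u\<^sup>2 + u * s + s\<^sup>2 / \<mu>"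
      using mu_pos by (simp add: power2_eq_square field_simps)
    finally show ?thesis using g_ge[OF that] by (simp add: F_def)
  qed
  have bdd: "bdd_below (F ` edom g)" using low by (auto intro!: bdd_belowI)
  have ne: "F ` edom g \<noteq> {}" using zero_in_edom by blast
  have m_le: "m \<le> F u" if "u \<in> edom g" for u
    unfolding m_def using that bdd by (intro cInf_lower) auto
  have "\<exists>u\<in>edom g. F u < m + 1 / Suc n" for n :: nat
    using cInf_lessD[OF ne, of "m + 1 / Suc n"] by (auto simp: m_def)
  then obtain X where X: "\<And>n. X n \<in> edom g" "\<And>n. F (X n) < m + 1 / Suc n" by metis
  have dist: "\<mu> / 4 * (X i - X j)\<^sup>2 \<le> 1 / Suc i + 1 / Suc j" for i j
  proof -
    note mid = gr_strongly_convex[OF X(1)[of i] X(1)[of j], of "1/2"]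
    have "\<mu> / 8 * (X i - X j)\<^sup>2 + m \<le> \<mu> / 8 * (X i - X j)\<^sup>2 + F (X i / 2 + X j / 2)"
      using m_le mid(1) by simp
    also have "\<dots> \<le> F (X i) / 2 + F (X j) / 2"
      using mid(2) by (simp add: F_def field_simps)
    finally show ?thesis using X(2)[of i] X(2)[of j] by linarith
  qed
  have "Cauchy X"
  proof (rule metric_CauchyI)
    fix e :: real assume "0 < e"
    hence "0 < \<mu> / 8 * e\<^sup>2" using mu_pos by simp
    then obtain N :: nat where N: "1 / Suc N < \<mu> / 8 * e\<^sup>2" using nat_approx_posE by blast
    show "\<exists>M. \<forall>i\<ge>M. \<forall>j\<ge>M. dist (X i) (X j) < e"
    proof (intro exI[of _ N] allI impI)
      fix i j assume "i \<ge> N" "j \<ge> N"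
      hence "1 / real (Suc i) \<le> 1 / Suc N" "1 / real (Suc j) \<le> 1 / Suc N" by (auto simp: field_simps)
      hence "\<mu> / 4 * (X i - X j)\<^sup>2 < \<mu> / 4 * e\<^sup>2" using dist[of i j] N by linarith
      hence "(X i - X j)\<^sup>2 < e\<^sup>2" using mu_pos by simp
      thus "dist (X i) (X j) < e"
        using \<open>0 < e\<close> power2_less_imp_less[of "\<bar>X i - X j\<bar>" e] by (simp add: dist_real_def)
    qed
  qed
  then obtain w where w: "X \<longlonglongrightarrow> w" using Cauchy_convergent convergent_def by blast
  have "(\<lambda>n. ereal (m + 1 / Suc n - X n * s)) \<longlonglongrightarrow> ereal (m - w * s)"
  proof (rule tendsto_ereal)
    have "(\<lambda>n. 1 / real (Suc n)) \<longlonglongrightarrow> 0" using LIMSEQ_inverse_real_of_nat by (simp add: inverse_eq_divide)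
    from tendsto_diff[OF tendsto_add[OF tendsto_const[of m] this] tendsto_mult_right[OF w, of s]]
    show "(\<lambda>n. m + 1 / Suc n - X n * s) \<longlonglongrightarrow> m - w * s" by simp
  qed
  hence lim: "liminf (\<lambda>n. ereal (m + 1 / Suc n - X n * s)) = ereal (m - w * s)"
    by (simp add: lim_imp_Liminf)
  have "g w \<le> liminf (\<lambda>n. g (X n))" by (rule g_sequentially_lsc[OF w])
  also have "\<dots> \<le> liminf (\<lambda>n. ereal (m + 1 / Suc n - X n * s))"
  proof (intro Liminf_mono always_eventually allI)
    fix n show "g (X n) \<le> ereal (m + 1 / Suc n - X n * s)"
      using X(2)[of n] by (subst X(1)[of n, unfolded edom_iff]) (simp add: F_def)
  qed
  finally have gw: "g w \<le> ereal (m - w * s)" unfolding lim .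
  hence "w \<in> edom g" by (auto simp: edom_def)
  moreover from this have "ereal (gr w) \<le> ereal (m - w * s)" using gw edom_iff by metis
  hence "F w \<le> m" by (simp add: F_def)
  ultimately show ?thesis using m_le unfolding F_def by (meson order.trans)
qed

text \<open>This is the derivative of the convex conjugate of \<open>g\<close> at \<open>- s\<close>.\<close>

definition tilt_argmin :: "real \<Rightarrow> real" where
  "tilt_argmin s = (SOME w. w \<in> edom g \<and> (\<forall>u\<in>edom g. w * s + gr w \<le> u * s + gr u))"

lemma tilt_argmin_in_edom: "tilt_argmin s \<in> edom g"
  and tilt_argmin_minimal: "u \<in> edom g \<Longrightarrow> tilt_argmin s * s + gr (tilt_argmin s) \<le> u * s + gr u"
proof -
  have "\<exists>w. w \<in> edom g \<and> (\<forall>u\<in>edom g. w * s + gr w \<le> u * s + gr u)"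
    using ex_minimizer_tilted by blast
  from someI_ex[OF this] show "tilt_argmin s \<in> edom g"
    and "u \<in> edom g \<Longrightarrow> tilt_argmin s * s + gr (tilt_argmin s) \<le> u * s + gr u"
    unfolding tilt_argmin_def by blast+
qed

text \<open>Compare the minimizer with its convex combinations with \<open>u\<close>, divide by the weight \<open>t\<close> of \<open>u\<close> and
  let \<open>t\<close> tend to 0.\<close>

lemma tilt_argmin_quadratic_growth:
  assumes u: "u \<in> edom g"
  shows "tilt_argmin s * s + gr (tilt_argmin s) + \<mu> / 2 * (u - tilt_argmin s)\<^sup>2 \<le> u * s + gr u"
proof -
  let ?w = "tilt_argmin s"
  have ineq: "\<mu> / 2 * (1 - t) * (u - ?w)\<^sup>2 \<le> (u * s + gr u) - (?w * s + gr ?w)" if t: "0 < t" "t < 1" for t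
  proof -
    note mid = gr_strongly_convex[OF u tilt_argmin_in_edom[of s], of t]
    have "?w * s + gr ?w \<le> (t * u + (1 - t) * ?w) * s + gr (t * u + (1 - t) * ?w)"
      using mid(1) t by (intro tilt_argmin_minimal) auto
    also have "\<dots> \<le> (t * u + (1 - t) * ?w) * s + t * gr u + (1 - t) * gr ?w
         - \<mu> / 2 * t * (1 - t) * (u - ?w)\<^sup>2"
      using mid(2) t by simp
    finally have "t * (\<mu> / 2 * (1 - t) * (u - ?w)\<^sup>2) \<le> t * ((u * s + gr u) - (?w * s + gr ?w))"
      by (simp add: algebra_simps)
    thus ?thesis using t by simp
  qed
  have "((\<lambda>t. \<mu> / 2 * (1 - t) * (u - ?w)\<^sup>2) \<longlongrightarrow> \<mu> / 2 * (1 - 0) * (u - ?w)\<^sup>2) (at_right 0)"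
    by (intro tendsto_intros)
  moreover have "eventually (\<lambda>t. \<mu> / 2 * (1 - t) * (u - ?w)\<^sup>2 \<le> (u * s + gr u) - (?w * s + gr ?w)) (at_right (0::real))"
    using ineq by (auto simp: eventually_at_right_field intro!: exI[of _ 1])
  ultimately have "\<mu> / 2 * (1 - 0) * (u - ?w)\<^sup>2 \<le> (u * s + gr u) - (?w * s + gr ?w)"
    by (intro tendsto_upperbound) auto
  thus ?thesis by simp
qed

text \<open>Add the growth estimates of the two minimizers, each tested with the other one.\<close>

lemma tilt_argmin_lipschitz: "\<mu> * \<bar>tilt_argmin s - tilt_argmin t\<bar> \<le> \<bar>s - t\<bar>"
proof (cases "tilt_argmin s = tilt_argmin t")
  case False
  let ?d = "tilt_argmin s - tilt_argmin t"
  have "\<mu> * ?d\<^sup>2 \<le> ?d * (t - s)"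
    using tilt_argmin_quadratic_growth[OF tilt_argmin_in_edom[of t], of s] tilt_argmin_quadratic_growth[OF tilt_argmin_in_edom[of s], of t]
    by (simp add: algebra_simps power2_eq_square)
  also have "\<dots> \<le> \<bar>?d\<bar> * \<bar>s - t\<bar>" by (metis abs_ge_self abs_minus_commute abs_mult)
  finally have "\<bar>?d\<bar> * (\<mu> * \<bar>?d\<bar>) \<le> \<bar>?d\<bar> * \<bar>s - t\<bar>"
    by (simp add: power2_eq_square mult.left_commute mult.assoc)
  thus ?thesis using False by simp
qed simp

lemma tilt_argmin_0 [simp]: "tilt_argmin 0 = 0"
proof -
  have "gr (tilt_argmin 0) = 0"
    using tilt_argmin_minimal[OF zero_in_edom, of 0] gr_nonneg[of "tilt_argmin 0"] by simp
  thus ?thesis using tilt_argmin_in_edom[of 0] g_zero_iff edom_iff by (metis zero_ereal_def)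
qed

lemma abs_tilt_argmin_le: "\<bar>tilt_argmin s\<bar> \<le> \<bar>s\<bar> / \<mu>"
  using tilt_argmin_lipschitz[of s 0] mu_pos by (simp add: field_simps)

lemma borel_measurable_tilt_argmin [measurable]: "tilt_argmin \<in> borel_measurable borel"
proof (rule borel_measurable_continuous_onI)
  have "(1 / \<mu>)-lipschitz_on UNIV tilt_argmin"
    using tilt_argmin_lipschitz mu_pos by (intro lipschitz_onI) (auto simp: dist_real_def field_simps)
  thus "continuous_on UNIV tilt_argmin" by (rule lipschitz_on_continuous_on)
qed

lemma gr_tilt_argmin_le: "gr (tilt_argmin s) \<le> s\<^sup>2 / \<mu>"
proof -
  have "gr (tilt_argmin s) \<le> \<bar>tilt_argmin s\<bar> * \<bar>s\<bar>"
    using tilt_argmin_minimal[OF zero_in_edom, of s] abs_ge_minus_self[of "tilt_argmin s * s"] by (simp add: abs_mult)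
  also have "\<dots> \<le> \<bar>s\<bar> / \<mu> * \<bar>s\<bar>" using abs_tilt_argmin_le by (intro mult_right_mono) auto
  finally show ?thesis by (simp add: power2_eq_square)
qed

end

section \<open>Square integrable functions\<close>

lemma Lp_measurable: "u \<in> Lp p M \<Longrightarrow> u \<in> borel_measurable M"
  by (simp add: Lp_def)

lemma mem_L2_iff: "u \<in> Lp 2 M \<longleftrightarrow> u \<in> borel_measurable M \<and> integrable M (\<lambda>x. (u x)\<^sup>2)"
proof -
  have "\<bar>u x\<bar> powr 2 = (u x)\<^sup>2" for x by (cases "u x = 0") (simp_all add: powr_numeral)
  thus ?thesis by (simp add: Lp_def)
qed

lemma L2_norm_eq: "Lp_norm 2 M u = sqrt (\<integral>x. (u x)\<^sup>2 \<partial>M)"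
proof -
  have "\<bar>u x\<bar> powr 2 = (u x)\<^sup>2" for x by (cases "u x = 0") (simp_all add: powr_numeral)
  thus ?thesis by (simp add: Lp_norm_def powr_half_sqrt)
qed

lemma L2_mult_integrable:
  assumes "u \<in> Lp 2 M" "v \<in> Lp 2 M"
  shows "integrable M (\<lambda>x. u x * v x)"
proof (rule Bochner_Integration.integrable_bound[where f="\<lambda>x. (u x)\<^sup>2 + (v x)\<^sup>2"])
  show "AE x in M. norm (u x * v x) \<le> norm ((u x)\<^sup>2 + (v x)\<^sup>2)"
  proof (intro AE_I2)
    fix x
    have "\<bar>u x * v x\<bar> \<le> (u x)\<^sup>2 + (v x)\<^sup>2"
    proof -
      have "2 * (\<bar>u x\<bar> * \<bar>v x\<bar>) \<le> (u x)\<^sup>2 + (v x)\<^sup>2"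
        using zero_le_power2[of "\<bar>u x\<bar> - \<bar>v x\<bar>"] by (simp add: power2_diff)
      moreover have "0 \<le> \<bar>u x\<bar> * \<bar>v x\<bar>" by simp
      ultimately show ?thesis unfolding abs_mult by linarith
    qed
    thus "norm (u x * v x) \<le> norm ((u x)\<^sup>2 + (v x)\<^sup>2)" by simp
  qed
qed (use assms in \<open>auto simp: mem_L2_iff\<close>)

lemma L2_dominated:
  assumes "v \<in> Lp 2 M" "u \<in> borel_measurable M" "\<And>x. \<bar>u x\<bar> \<le> \<bar>c * v x\<bar>"
  shows "u \<in> Lp 2 M"
  unfolding mem_L2_iff
proof
  show "integrable M (\<lambda>x. (u x)\<^sup>2)"
  proof (rule Bochner_Integration.integrable_bound[where f="\<lambda>x. c\<^sup>2 * (v x)\<^sup>2"])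
    show "AE x in M. norm ((u x)\<^sup>2) \<le> norm (c\<^sup>2 * (v x)\<^sup>2)"
      using power_mono[OF assms(3) abs_ge_zero, where n=2] by (simp add: power_mult_distrib)
  qed (use assms in \<open>auto simp: mem_L2_iff\<close>)
qed (fact assms(2))

lemma L2_scale: "u \<in> Lp 2 M \<Longrightarrow> (\<lambda>x. c * u x) \<in> Lp 2 M"
  by (rule L2_dominated[where c=c]) (auto dest: Lp_measurable)

lemma L2_add:
  assumes "u \<in> Lp 2 M" "v \<in> Lp 2 M" shows "(\<lambda>x. u x + v x) \<in> Lp 2 M"
  using assms L2_mult_integrable[OF assms] Lp_measurable[OF assms(1)] Lp_measurable[OF assms(2)]
  by (simp add: mem_L2_iff power2_sum mult.assoc)

lemma L2_diff:
  assumes "u \<in> Lp 2 M" "v \<in> Lp 2 M" shows "(\<lambda>x. u x - v x) \<in> Lp 2 M"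
  using L2_add[OF assms(1) L2_scale[OF assms(2), of "-1"]] by simp

lemma L2_indicator:
  assumes "u \<in> Lp 2 M" "A \<in> sets M" shows "(\<lambda>x. indicator A x * u x) \<in> Lp 2 M"
proof (rule L2_dominated[OF assms(1)])
  show "(\<lambda>x. indicator A x * u x) \<in> borel_measurable M"
    using assms by (intro borel_measurable_times borel_measurable_indicator) (auto intro: Lp_measurable)
  show "\<bar>indicator A x * u x\<bar> \<le> \<bar>1 * u x\<bar>" for x by (simp add: indicator_def)
qed

lemma L2_zero: "(\<lambda>x. 0) \<in> Lp 2 M"
  by (simp add: mem_L2_iff)

lemma (in finite_measure) L1_norm_le_L2_norm:
  assumes "u \<in> Lp 2 M"
  shows "(\<integral>x. \<bar>u x\<bar> \<partial>M) \<le> sqrt (measure M (space M) * (\<integral>x. (u x)\<^sup>2 \<partial>M))"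
proof -
  have [measurable]: "u \<in> borel_measurable M" and u2: "integrable M (\<lambda>x. (u x)\<^sup>2)"
    using assms by (auto simp: mem_L2_iff)
  have u1: "integrable M (\<lambda>x. \<bar>u x\<bar>)"
    using square_integrable_imp_integrable[OF _ u2] by simp
  have "(\<integral>\<^sup>+x. ennreal \<bar>u x\<bar> * 1 \<partial>M)\<^sup>2 \<le> (\<integral>\<^sup>+x. (ennreal \<bar>u x\<bar>)\<^sup>2 \<partial>M) * (\<integral>\<^sup>+x. 1\<^sup>2 \<partial>M)"
    by (rule Cauchy_Schwarz_nn_integral) auto
  hence "(ennreal (\<integral>x. \<bar>u x\<bar> \<partial>M))\<^sup>2 \<le> ennreal (\<integral>x. (u x)\<^sup>2 \<partial>M) * ennreal (measure M (space M))"
    using u1 u2 by (simp add: nn_integral_eq_integral ennreal_power emeasure_eq_measure)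
  hence "ennreal ((\<integral>x. \<bar>u x\<bar> \<partial>M)\<^sup>2) \<le> ennreal ((\<integral>x. (u x)\<^sup>2 \<partial>M) * measure M (space M))"
    by (simp add: ennreal_power ennreal_mult)
  hence "(\<integral>x. \<bar>u x\<bar> \<partial>M)\<^sup>2 \<le> measure M (space M) * (\<integral>x. (u x)\<^sup>2 \<partial>M)"
    by (simp add: ennreal_le_iff mult.commute)
  thus ?thesis by (rule real_le_rsqrt)
qed

text \<open>Riesz-Fischer: on a finite measure space a Cauchy sequence in \<open>L\<^sup>2\<close> is Cauchy in \<open>L\<^sup>1\<close>, so a
  subsequence converges almost everywhere; Fatou's lemma identifies the limit as a limit in \<open>L\<^sup>2\<close>.
  The almost everywhere convergence is part of the conclusion because the cost of a limit of controls
  is estimated by Fatou's lemma too.\<close>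

theorem (in finite_measure) L2_complete:
  assumes X: "\<And>n. X n \<in> Lp 2 M"
    and Cauchy: "\<And>e. 0 < e \<Longrightarrow> \<exists>N. \<forall>i\<ge>N. \<forall>j\<ge>N. (\<integral>x. (X i x - X j x)\<^sup>2 \<partial>M) < e"
  obtains r :: "nat \<Rightarrow> nat" and u where "strict_mono r" "u \<in> Lp 2 M"
    "AE x in M. (\<lambda>n. X (r n) x) \<longlonglongrightarrow> u x"
    "(\<lambda>n. \<integral>x. (X (r n) x - u x)\<^sup>2 \<partial>M) \<longlonglongrightarrow> 0"
proof -
  have [measurable]: "X n \<in> borel_measurable M" for n using X by (auto simp: mem_L2_iff)
  have int: "integrable M (X n)" for n
    using square_integrable_imp_integrable[of "X n"] X[of n] by (auto simp: mem_L2_iff)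
  let ?m = "measure M (space M)"
  have "\<exists>N. \<forall>i\<ge>N. \<forall>j\<ge>N. (\<integral>x. norm (X i x - X j x) \<partial>M) < e" if "0 < e" for e
  proof -
    have pos: "0 < ?m + 1" by (simp add: add_nonneg_pos)
    obtain N where N: "\<forall>i\<ge>N. \<forall>j\<ge>N. (\<integral>x. (X i x - X j x)\<^sup>2 \<partial>M) < e\<^sup>2 / (?m + 1)"
      using Cauchy[of "e\<^sup>2 / (?m + 1)"] \<open>0 < e\<close> pos by (meson divide_pos_pos zero_less_power)
    have "(\<integral>x. norm (X i x - X j x) \<partial>M) < e" if "i \<ge> N" "j \<ge> N" for i j
    proof -
      let ?I = "\<integral>x. (X i x - X j x)\<^sup>2 \<partial>M"
      have "(\<integral>x. norm (X i x - X j x) \<partial>M) \<le> sqrt (?m * ?I)"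
        using L1_norm_le_L2_norm[OF L2_diff[OF X[of i] X[of j]]] by simp
      also have "?m * ?I \<le> (?m + 1) * ?I" by (intro mult_right_mono) auto
      also have "(?m + 1) * ?I < e\<^sup>2" using N that pos by (simp add: field_simps)
      finally show ?thesis using \<open>0 < e\<close> by simp
    qed
    thus ?thesis by blast
  qed
  from cauchy_L1_AE_cauchy_subseq[OF int this] obtain r
    where r: "strict_mono r" "AE x in M. Cauchy (\<lambda>i. X (r i) x)" by blast
  define u where "u x = lim (\<lambda>i. X (r i) x)" for x
  have [measurable]: "u \<in> borel_measurable M" unfolding u_def by measurable
  have lim: "AE x in M. (\<lambda>n. X (r n) x) \<longlonglongrightarrow> u x"
    using r(2) by eventually_elim (simp add: u_def Cauchy_convergent_iff convergent_LIMSEQ_iff)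
  have fatou: "(\<integral>\<^sup>+x. ennreal ((X i x - u x)\<^sup>2) \<partial>M) \<le> ennreal e"
    if i: "\<forall>j\<ge>N. (\<integral>x. (X i x - X j x)\<^sup>2 \<partial>M) < e" for i N e
  proof -
    have "(\<integral>\<^sup>+x. ennreal ((X i x - u x)\<^sup>2) \<partial>M)
        = (\<integral>\<^sup>+x. liminf (\<lambda>n. ennreal ((X i x - X (r n) x)\<^sup>2)) \<partial>M)"
    proof (rule nn_integral_cong_AE)
      show "AE x in M. ennreal ((X i x - u x)\<^sup>2) = liminf (\<lambda>n. ennreal ((X i x - X (r n) x)\<^sup>2))"
        using lim
      proof eventually_elim
        case (elim x)
        hence "(\<lambda>n. ennreal ((X i x - X (r n) x)\<^sup>2)) \<longlonglongrightarrow> ennreal ((X i x - u x)\<^sup>2)"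
          by (intro tendsto_ennrealI tendsto_intros)
        from lim_imp_Liminf[OF _ this] show ?case by simp
      qed
    qed
    also have "\<dots> \<le> liminf (\<lambda>n. \<integral>\<^sup>+x. ennreal ((X i x - X (r n) x)\<^sup>2) \<partial>M)"
      by (rule nn_integral_liminf) measurable
    also have "\<dots> \<le> liminf (\<lambda>n. ennreal e)"
    proof (rule Liminf_mono)
      have "(\<integral>\<^sup>+x. ennreal ((X i x - X (r n) x)\<^sup>2) \<partial>M) \<le> ennreal e" if "n \<ge> N" for n
      proof -
        have "N \<le> r n" using that seq_suble[OF r(1), of n] by simp
        hence "(\<integral>x. (X i x - X (r n) x)\<^sup>2 \<partial>M) \<le> e" using i by (simp add: less_imp_le)
        moreover have "(\<integral>\<^sup>+x. ennreal ((X i x - X (r n) x)\<^sup>2) \<partial>M) = ennreal (\<integral>x. (X i x - X (r n) x)\<^sup>2 \<partial>M)"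
          using L2_diff[OF X[of i] X[of "r n"]] by (intro nn_integral_eq_integral) (auto simp: mem_L2_iff)
        ultimately show ?thesis by (simp add: ennreal_leI)
      qed
      thus "eventually (\<lambda>n. (\<integral>\<^sup>+x. ennreal ((X i x - X (r n) x)\<^sup>2) \<partial>M) \<le> ennreal e) sequentially"
        by (auto simp: eventually_sequentially)
    qed
    also have "\<dots> = ennreal e" by (simp add: Liminf_const)
    finally show ?thesis .
  qed
  have diff_L2: "(\<lambda>x. X i x - u x) \<in> Lp 2 M"
    and diff_le: "0 < e \<Longrightarrow> (\<integral>x. (X i x - u x)\<^sup>2 \<partial>M) \<le> e"
    if i: "\<forall>j\<ge>N. (\<integral>x. (X i x - X j x)\<^sup>2 \<partial>M) < e" for i N e
  proof -
    show *: "(\<lambda>x. X i x - u x) \<in> Lp 2 M"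
      unfolding mem_L2_iff using fatou[OF i] by (auto simp: integrable_iff_bounded intro: le_less_trans)
    assume "0 < e"
    have "ennreal (\<integral>x. (X i x - u x)\<^sup>2 \<partial>M) \<le> ennreal e"
      using fatou[OF i] * by (subst nn_integral_eq_integral[symmetric]) (auto simp: mem_L2_iff)
    thus "(\<integral>x. (X i x - u x)\<^sup>2 \<partial>M) \<le> e" using \<open>0 < e\<close> by (simp add: ennreal_le_iff)
  qed
  obtain N where "\<forall>i\<ge>N. \<forall>j\<ge>N. (\<integral>x. (X i x - X j x)\<^sup>2 \<partial>M) < 1" using Cauchy[of 1] by auto
  hence "\<forall>j\<ge>N. (\<integral>x. (X N x - X j x)\<^sup>2 \<partial>M) < 1" by blast
  from L2_diff[OF X[of N] diff_L2[OF this]] have "u \<in> Lp 2 M" by simp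
  moreover have "(\<lambda>n. \<integral>x. (X (r n) x - u x)\<^sup>2 \<partial>M) \<longlonglongrightarrow> 0"
  proof (rule LIMSEQ_I)
    fix e :: real assume "0 < e"
    then obtain N where N: "\<forall>i\<ge>N. \<forall>j\<ge>N. (\<integral>x. (X i x - X j x)\<^sup>2 \<partial>M) < e/2"
      using Cauchy[of "e/2"] by auto
    have "norm ((\<integral>x. (X (r n) x - u x)\<^sup>2 \<partial>M) - 0) < e" if "n \<ge> N" for n
    proof -
      have "N \<le> r n" using that seq_suble[OF r(1), of n] by simp
      hence "(\<integral>x. (X (r n) x - u x)\<^sup>2 \<partial>M) \<le> e/2" using N \<open>0 < e\<close> by (intro diff_le[of N]) auto
      moreover have "0 \<le> (\<integral>x. (X (r n) x - u x)\<^sup>2 \<partial>M)" by simp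
      ultimately show ?thesis using \<open>0 < e\<close> by simp
    qed
    thus "\<exists>N. \<forall>n\<ge>N. norm ((\<integral>x. (X (r n) x - u x)\<^sup>2 \<partial>M) - 0) < e" by blast
  qed
  ultimately show ?thesis using that r(1) lim by blast
qed

section \<open>The control problem and existence of optimal controls\<close>

lemma ext_integral_eq_integral:
  assumes "integrable M h" "AE x in M. f x = ereal (h x)"
  shows "ext_integral M f = ereal (\<integral>x. h x \<partial>M)"
proof -
  have "(\<integral>\<^sup>+x. e2ennreal (f x) \<partial>M) = (\<integral>\<^sup>+x. ennreal (h x) \<partial>M)"
    using assms(2) by (intro nn_integral_cong_AE) (auto simp: ennreal.abs_eq e2ennreal_ereal)
  moreover have "(\<integral>\<^sup>+x. e2ennreal (- f x) \<partial>M) = (\<integral>\<^sup>+x. ennreal (- h x) \<partial>M)"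
    using assms(2) by (intro nn_integral_cong_AE) (auto simp: e2ennreal_ereal)
  moreover obtain a b where "0 \<le> a" "0 \<le> b" "(\<integral>\<^sup>+x. ennreal (h x) \<partial>M) = ennreal a"
      "(\<integral>\<^sup>+x. ennreal (- h x) \<partial>M) = ennreal b" "(\<integral>x. h x \<partial>M) = a - b"
    using integrableE[OF assms(1)] by metis
  ultimately show ?thesis by (simp add: ext_integral_def enn2ereal_ennreal)
qed

text \<open>The negative part of the integrable summand takes away only a finite amount from the infinite
  integral of the positive part, and it bounds the negative part of the sum.\<close>

lemma ext_integral_add_eq_infinity:
  assumes b: "integrable M b" and [measurable]: "f \<in> borel_measurable M"
    and f: "(\<integral>\<^sup>+x. e2ennreal (f x) \<partial>M) = \<infinity>" "\<And>x. 0 \<le> f x"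
  shows "ext_integral M (\<lambda>x. f x + ereal (b x)) = \<infinity>"
proof -
  have [measurable]: "b \<in> borel_measurable M" using b by auto
  have fin: "(\<integral>\<^sup>+x. ennreal (- b x) \<partial>M) < \<infinity>"
    using integrableE[OF b] by (metis ennreal_less_top infinity_ennreal_def)
  have "\<infinity> \<le> (\<integral>\<^sup>+x. e2ennreal (f x + ereal (b x)) + ennreal (- b x) \<partial>M)"
    unfolding f(1)[symmetric]
  proof (rule nn_integral_mono)
    fix x
    show "e2ennreal (f x) \<le> e2ennreal (f x + ereal (b x)) + ennreal (- b x)"
    proof (cases "f x")
      case (real r)
      hence "ennreal r \<le> ennreal (max 0 (r + b x) + max 0 (- b x))" by (intro ennreal_leI) auto
      also have "\<dots> = ennreal (r + b x) + ennreal (- b x)"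
      proof -
        have "ennreal (max 0 z) = ennreal z" for z by (simp add: max_def ennreal_neg)
        thus ?thesis by (simp add: ennreal_plus)
      qed
      finally show ?thesis using real by (simp add: e2ennreal_ereal)
    next
      case PInf thus ?thesis by (simp add: e2ennreal_infty)
    qed (use f(2)[of x] in auto)
  qed
  also have "\<dots> = (\<integral>\<^sup>+x. e2ennreal (f x + ereal (b x)) \<partial>M) + (\<integral>\<^sup>+x. ennreal (- b x) \<partial>M)"
    by (rule nn_integral_add) auto
  finally have pos: "(\<integral>\<^sup>+x. e2ennreal (f x + ereal (b x)) \<partial>M) = \<infinity>"
    using fin by (auto simp: top_unique)
  have "(\<integral>\<^sup>+x. e2ennreal (- (f x + ereal (b x))) \<partial>M) \<le> (\<integral>\<^sup>+x. ennreal (- b x) \<partial>M)"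
  proof (rule nn_integral_mono)
    fix x
    have "- (f x + ereal (b x)) \<le> ereal (- b x)" using f(2)[of x] by (cases "f x") auto
    thus "e2ennreal (- (f x + ereal (b x))) \<le> ennreal (- b x)"
      using e2ennreal_mono by (fastforce simp: e2ennreal_ereal)
  qed
  hence "(\<integral>\<^sup>+x. e2ennreal (- (f x + ereal (b x))) \<partial>M) < \<infinity>" using fin by (rule le_less_trans)
  thus ?thesis unfolding ext_integral_def pos
    by (cases "\<integral>\<^sup>+x. e2ennreal (- (f x + ereal (b x))) \<partial>M") (auto simp: enn2ereal_ennreal)
qed

text \<open>The minimization over controls for a fixed set, on an arbitrary finite measure space; the geometry
  of the domain enters only with the topological derivative.\<close>

locale control_problem = finite_measure M + strongly_convex_integrand g \<mu>
  for M :: "'a measure" and g \<mu> +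
  fixes S :: "('a \<Rightarrow> real) \<Rightarrow> 'y::real_inner" and S_adj :: "'y \<Rightarrow> 'a \<Rightarrow> real"
    and yd :: 'y and \<beta> :: "'a \<Rightarrow> real"
  assumes S_bounded_linear: "bounded_linear_on_Lp 2 M S"
    and S_adjoint: "is_L2_adjoint M S S_adj"
    and beta_L1: "integrable M \<beta>"
begin

definition cost :: "('a \<Rightarrow> real) \<Rightarrow> 'a set \<Rightarrow> ereal" where
  "cost u A = ereal (1 / 2 * (norm (S (\<lambda>x. indicator A x * u x) - yd))\<^sup>2)
     + ext_integral M (\<lambda>x. g (u x) + ereal (indicator A x * \<beta> x))"

definition min_cost :: "'a set \<Rightarrow> ereal" where
  "min_cost A = (LEAST m. \<exists>u\<in>Lp 2 M. m = cost u A)"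

text \<open>The controls of finite cost.\<close>

definition admissible :: "('a \<Rightarrow> real) set" where
  "admissible = {u \<in> Lp 2 M. (AE x in M. u x \<in> edom g) \<and> integrable M (\<lambda>x. gr (u x))}"

definition state :: "'a set \<Rightarrow> ('a \<Rightarrow> real) \<Rightarrow> 'y" where
  "state A u = S (\<lambda>x. indicator A x * u x)"

text \<open>The cost as a real number, meaningful for admissible controls.\<close>

definition real_cost :: "('a \<Rightarrow> real) \<Rightarrow> 'a set \<Rightarrow> real" where
  "real_cost u A = 1 / 2 * (norm (state A u - yd))\<^sup>2 + (\<integral>x. gr (u x) \<partial>M) + (\<integral>x. indicator A x * \<beta> x \<partial>M)"

lemma admissibleD:
  assumes "u \<in> admissible"
  shows "u \<in> Lp 2 M" "AE x in M. u x \<in> edom g" "integrable M (\<lambda>x. gr (u x))"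
    "u \<in> borel_measurable M"
  using assms Lp_measurable by (auto simp: admissible_def)

lemma indicator_beta_integrable: "A \<in> sets M \<Longrightarrow> integrable M (\<lambda>x. indicator A x * \<beta> x)"
  using integrable_mult_indicator[OF _ beta_L1] by simp

lemma nn_integral_g_admissible:
  assumes "u \<in> admissible"
  shows "(\<integral>\<^sup>+x. e2ennreal (g (u x)) \<partial>M) = ennreal (\<integral>x. gr (u x) \<partial>M)"
proof -
  have "(\<integral>\<^sup>+x. e2ennreal (g (u x)) \<partial>M) = (\<integral>\<^sup>+x. ennreal (gr (u x)) \<partial>M)"
  proof (rule nn_integral_cong_AE)
    show "AE x in M. e2ennreal (g (u x)) = ennreal (gr (u x))"
      using admissibleD(2)[OF assms] by eventually_elim (metis edom_iff e2ennreal_ereal)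
  qed
  also have "\<dots> = ennreal (\<integral>x. gr (u x) \<partial>M)"
    using admissibleD(3)[OF assms] gr_nonneg by (intro nn_integral_eq_integral) auto
  finally show ?thesis .
qed

lemma admissible_if_nn_integral_finite:
  assumes u: "u \<in> Lp 2 M" and fin: "(\<integral>\<^sup>+x. e2ennreal (g (u x)) \<partial>M) < \<infinity>"
  shows "u \<in> admissible"
proof -
  have [measurable]: "u \<in> borel_measurable M" using u by (rule Lp_measurable)
  have "AE x in M. e2ennreal (g (u x)) \<noteq> \<infinity>"
    using fin by (intro nn_integral_PInf_AE) auto
  hence dom: "AE x in M. u x \<in> edom g"
  proof eventually_elim
    case (elim x)
    hence "g (u x) \<noteq> \<infinity>" by (auto simp: e2ennreal_infty)
    thus ?case by (cases "g (u x)") (auto simp: edom_def)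
  qed
  have "(\<integral>\<^sup>+x. ennreal (gr (u x)) \<partial>M) = (\<integral>\<^sup>+x. e2ennreal (g (u x)) \<partial>M)"
  proof (rule nn_integral_cong_AE)
    show "AE x in M. ennreal (gr (u x)) = e2ennreal (g (u x))"
      using dom by eventually_elim (metis edom_iff e2ennreal_ereal)
  qed
  hence "integrable M (\<lambda>x. gr (u x))"
    using fin gr_nonneg by (intro integrableI_bounded) auto
  thus ?thesis using u dom by (simp add: admissible_def)
qed

lemma cost_eq:
  assumes u: "u \<in> Lp 2 M" and A: "A \<in> sets M"
  shows "cost u A = (if u \<in> admissible then ereal (real_cost u A) else \<infinity>)"
proof (cases "u \<in> admissible")
  case True
  have "ext_integral M (\<lambda>x. g (u x) + ereal (indicator A x * \<beta> x))
      = ereal (\<integral>x. gr (u x) + indicator A x * \<beta> x \<partial>M)"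
  proof (rule ext_integral_eq_integral)
    show "integrable M (\<lambda>x. gr (u x) + indicator A x * \<beta> x)"
      using admissibleD(3)[OF True] indicator_beta_integrable[OF A] by simp
    show "AE x in M. g (u x) + ereal (indicator A x * \<beta> x) = ereal (gr (u x) + indicator A x * \<beta> x)"
      using admissibleD(2)[OF True] by eventually_elim (metis edom_iff plus_ereal.simps(1))
  qed
  thus ?thesis using True admissibleD(3)[OF True] indicator_beta_integrable[OF A]
    by (simp add: cost_def real_cost_def state_def)
next
  case False
  have [measurable]: "u \<in> borel_measurable M" using u by (rule Lp_measurable)
  have "(\<integral>\<^sup>+x. e2ennreal (g (u x)) \<partial>M) = \<infinity>"
    using admissible_if_nn_integral_finite[OF u] False by (metis infinity_ennreal_def less_top)
  hence "ext_integral M (\<lambda>x. g (u x) + ereal (indicator A x * \<beta> x)) = \<infinity>"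
    using indicator_beta_integrable[OF A] g_nonneg by (intro ext_integral_add_eq_infinity) auto
  thus ?thesis using False by (simp add: cost_def)
qed

text \<open>Fatou's lemma and the semicontinuity of \<open>g\<close>, in a form that also yields admissibility of the
  limit.\<close>

lemma integral_gr_lsc:
  assumes X: "\<And>n. X n \<in> admissible" and u: "u \<in> Lp 2 M"
    and lim: "AE x in M. (\<lambda>n. X n x) \<longlonglongrightarrow> u x"
    and le: "\<And>n. (\<integral>x. gr (X n x) \<partial>M) \<le> c n" and c: "c \<longlonglongrightarrow> c0"
  shows "u \<in> admissible" "(\<integral>x. gr (u x) \<partial>M) \<le> c0"
proof -
  have [measurable]: "u \<in> borel_measurable M" "X n \<in> borel_measurable M" for n
    using u X admissibleD(4) Lp_measurable by blast+
  have "(\<integral>\<^sup>+x. e2ennreal (g (u x)) \<partial>M) \<le> (\<integral>\<^sup>+x. liminf (\<lambda>n. e2ennreal (g (X n x))) \<partial>M)"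
  proof (rule nn_integral_mono_AE)
    show "AE x in M. e2ennreal (g (u x)) \<le> liminf (\<lambda>n. e2ennreal (g (X n x)))"
      using lim
    proof eventually_elim
      case (elim x)
      show ?case
      proof (rule le_Liminf_iff[THEN iffD2], intro allI impI)
        fix y assume y: "y < e2ennreal (g (u x))"
        hence "enn2ereal y < g (u x)"
          using g_nonneg[of "u x"] by (metis enn2ereal_e2ennreal less_ennreal.rep_eq)
        hence "eventually (\<lambda>n. enn2ereal y < g (X n x)) sequentially"
          using g_sequentially_lsc[OF elim] by (simp add: le_Liminf_iff)
        thus "eventually (\<lambda>n. y < e2ennreal (g (X n x))) sequentially"
          by eventually_elim (use g_nonneg in \<open>metis enn2ereal_e2ennreal less_ennreal.rep_eq\<close>)
      qed
    qed
  qed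
  also have "\<dots> \<le> liminf (\<lambda>n. \<integral>\<^sup>+x. e2ennreal (g (X n x)) \<partial>M)"
    by (rule nn_integral_liminf) measurable
  also have "\<dots> \<le> liminf (\<lambda>n. ennreal (c n))"
    by (intro Liminf_mono always_eventually allI) (simp add: nn_integral_g_admissible[OF X] ennreal_leI le)
  also have "\<dots> = ennreal c0"
    using c by (intro lim_imp_Liminf tendsto_ennrealI) auto
  finally have *: "(\<integral>\<^sup>+x. e2ennreal (g (u x)) \<partial>M) \<le> ennreal c0" .
  thus "u \<in> admissible" by (intro admissible_if_nn_integral_finite[OF u]) (auto intro: le_less_trans)
  have "0 \<le> c n" for n
  proof -
    have "0 \<le> (\<integral>x. gr (X n x) \<partial>M)" by (simp add: gr_nonneg)
    thus ?thesis using le[of n] by simp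
  qed
  hence "0 \<le> c0" by (intro LIMSEQ_le_const[OF c]) blast
  thus "(\<integral>x. gr (u x) \<partial>M) \<le> c0"
    using * nn_integral_g_admissible[OF \<open>u \<in> admissible\<close>] by (simp add: ennreal_le_iff)
qed

lemma admissible_zero: "(\<lambda>x. 0) \<in> admissible"
  by (simp add: admissible_def L2_zero)

lemma admissible_convex_combination:
  assumes u: "u \<in> admissible" and v: "v \<in> admissible" and t: "0 < t" "t < 1"
  shows "(\<lambda>x. t * u x + (1 - t) * v x) \<in> admissible"
    "\<mu> / 2 * t * (1 - t) * (\<integral>x. (u x - v x)\<^sup>2 \<partial>M) + (\<integral>x. gr (t * u x + (1 - t) * v x) \<partial>M)
       \<le> t * (\<integral>x. gr (u x) \<partial>M) + (1 - t) * (\<integral>x. gr (v x) \<partial>M)"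
proof -
  have [measurable]: "u \<in> borel_measurable M" "v \<in> borel_measurable M"
    using u v admissibleD(4) by blast+
  note int = admissibleD(3)[OF u] admissibleD(3)[OF v]
  have AE: "AE x in M. t * u x + (1 - t) * v x \<in> edom g \<and>
      \<mu> / 2 * t * (1 - t) * (u x - v x)\<^sup>2 + gr (t * u x + (1 - t) * v x)
        \<le> t * gr (u x) + (1 - t) * gr (v x)"
    using admissibleD(2)[OF u] admissibleD(2)[OF v]
    by eventually_elim (use gr_strongly_convex t in blast)
  have intm: "integrable M (\<lambda>x. gr (t * u x + (1 - t) * v x))"
  proof (rule Bochner_Integration.integrable_bound)
    show "integrable M (\<lambda>x. t * gr (u x) + (1 - t) * gr (v x))" using int by simp
    show "AE x in M. norm (gr (t * u x + (1 - t) * v x)) \<le> norm (t * gr (u x) + (1 - t) * gr (v x))"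
      using AE
    proof eventually_elim
      case (elim x)
      have "0 \<le> \<mu> / 2 * t * (1 - t) * (u x - v x)\<^sup>2" using mu_pos t by simp
      thus ?case using elim gr_nonneg by auto
    qed
  qed measurable
  have L2: "(\<lambda>x. t * u x + (1 - t) * v x) \<in> Lp 2 M"
    by (intro L2_add L2_scale admissibleD u v)
  thus "(\<lambda>x. t * u x + (1 - t) * v x) \<in> admissible"
    using AE intm by (auto simp: admissible_def)
  have intd: "integrable M (\<lambda>x. (u x - v x)\<^sup>2)"
    using L2_diff[OF admissibleD(1)[OF u] admissibleD(1)[OF v]] by (simp add: mem_L2_iff)
  have "(\<integral>x. \<mu> / 2 * t * (1 - t) * (u x - v x)\<^sup>2 + gr (t * u x + (1 - t) * v x) \<partial>M)
      \<le> (\<integral>x. t * gr (u x) + (1 - t) * gr (v x) \<partial>M)"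
    using AE int intm intd by (intro integral_mono_AE) (auto elim: eventually_mono)
  thus "\<mu> / 2 * t * (1 - t) * (\<integral>x. (u x - v x)\<^sup>2 \<partial>M) + (\<integral>x. gr (t * u x + (1 - t) * v x) \<partial>M)
       \<le> t * (\<integral>x. gr (u x) \<partial>M) + (1 - t) * (\<integral>x. gr (v x) \<partial>M)"
    using int intm intd by simp
qed

lemma S_add: "u \<in> Lp 2 M \<Longrightarrow> v \<in> Lp 2 M \<Longrightarrow> S (\<lambda>x. u x + v x) = S u + S v"
  and S_scale: "u \<in> Lp 2 M \<Longrightarrow> S (\<lambda>x. c * u x) = c *\<^sub>R S u"
  using S_bounded_linear unfolding bounded_linear_on_Lp_def by blast+

lemma S_diff:
  assumes "u \<in> Lp 2 M" "v \<in> Lp 2 M"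
  shows "S (\<lambda>x. u x - v x) = S u - S v"
  using S_add[OF assms(1) L2_scale[OF assms(2), of "-1"]] S_scale[OF assms(2), of "-1"] by simp

lemma S_bound:
  obtains C where "0 \<le> C" "\<And>u. u \<in> Lp 2 M \<Longrightarrow> norm (S u) \<le> C * sqrt (\<integral>x. (u x)\<^sup>2 \<partial>M)"
proof -
  obtain C where C: "\<And>u. u \<in> Lp 2 M \<Longrightarrow> norm (S u) \<le> C * sqrt (\<integral>x. (u x)\<^sup>2 \<partial>M)"
    using S_bounded_linear unfolding bounded_linear_on_Lp_def L2_norm_eq by blast
  have "norm (S u) \<le> \<bar>C\<bar> * sqrt (\<integral>x. (u x)\<^sup>2 \<partial>M)" if "u \<in> Lp 2 M" for u
    using C[OF that] by (rule order.trans) (intro mult_right_mono; simp)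
  thus ?thesis using that[of "\<bar>C\<bar>"] by simp
qed

lemma state_linear:
  assumes "u \<in> Lp 2 M" "v \<in> Lp 2 M" "A \<in> sets M"
  shows "state A (\<lambda>x. s * u x + t * v x) = s *\<^sub>R state A u + t *\<^sub>R state A v"
proof -
  note L2 = L2_indicator[OF assms(1,3)] L2_indicator[OF assms(2,3)]
  have "state A (\<lambda>x. s * u x + t * v x) = S (\<lambda>x. s * (indicator A x * u x) + t * (indicator A x * v x))"
    by (simp add: state_def algebra_simps)
  thus ?thesis using L2 by (simp add: S_add L2_scale S_scale state_def)
qed

lemma state_tendsto:
  assumes X: "\<And>n. X n \<in> Lp 2 M" and u: "u \<in> Lp 2 M" and A: "A \<in> sets M"
    and lim: "(\<lambda>n. \<integral>x. (X n x - u x)\<^sup>2 \<partial>M) \<longlonglongrightarrow> 0"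
  shows "(\<lambda>n. state A (X n)) \<longlonglongrightarrow> state A u"
proof -
  obtain C where C: "0 \<le> C" "\<And>u. u \<in> Lp 2 M \<Longrightarrow> norm (S u) \<le> C * sqrt (\<integral>x. (u x)\<^sup>2 \<partial>M)"
    using S_bound by blast
  have le: "norm (state A (X n) - state A u) \<le> C * sqrt (\<integral>x. (X n x - u x)\<^sup>2 \<partial>M)" for n
  proof -
    note d = L2_diff[OF X[of n] u]
    note dA = L2_indicator[OF d A]
    have "state A (X n) - state A u = S (\<lambda>x. indicator A x * (X n x - u x))"
      using state_linear[OF X[of n] u A, of 1 "-1"] by (simp add: state_def)
    also have "norm \<dots> \<le> C * sqrt (\<integral>x. (indicator A x * (X n x - u x))\<^sup>2 \<partial>M)"
      by (rule C(2)[OF dA])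
    also have "\<dots> \<le> C * sqrt (\<integral>x. (X n x - u x)\<^sup>2 \<partial>M)"
      using C(1) d dA
      by (intro mult_left_mono real_sqrt_le_mono integral_mono) (auto simp: mem_L2_iff indicator_def)
    finally show ?thesis .
  qed
  have "(\<lambda>n. C * sqrt (\<integral>x. (X n x - u x)\<^sup>2 \<partial>M)) \<longlonglongrightarrow> 0"
    using tendsto_mult_left[OF tendsto_real_sqrt[OF lim], of C] by simp
  from Lim_null_comparison[OF always_eventually[OF allI[OF le]] this]
  have "(\<lambda>n. state A (X n) - state A u) \<longlonglongrightarrow> 0" .
  thus ?thesis by (simp add: LIM_zero_iff)
qed

text \<open>The direct method without weak topologies: strong convexity makes a minimizing sequence Cauchy
  in \<open>L\<^sup>2\<close>.\<close>

theorem ex_minimizer: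
  assumes A: "A \<in> sets M"
  shows "\<exists>u\<in>admissible. \<forall>v\<in>admissible. real_cost u A \<le> real_cost v A"
proof -
  define b where "b = (\<integral>x. indicator A x * \<beta> x \<partial>M)"
  define m where "m = Inf ((\<lambda>u. real_cost u A) ` admissible)"
  have low: "b \<le> real_cost u A" for u
    using gr_nonneg by (simp add: real_cost_def b_def)
  have bdd: "bdd_below ((\<lambda>u. real_cost u A) ` admissible)" using low by (auto intro!: bdd_belowI)
  have ne: "(\<lambda>u. real_cost u A) ` admissible \<noteq> {}" using admissible_zero by blast
  have m_le: "m \<le> real_cost u A" if "u \<in> admissible" for u
    unfolding m_def using that bdd by (intro cInf_lower) auto
  have "\<exists>u\<in>admissible. real_cost u A < m + 1 / Suc n" for n :: nat
    using cInf_lessD[OF ne, of "m + 1 / Suc n"] by (auto simp: m_def)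
  then obtain X where X: "\<And>n. X n \<in> admissible" "\<And>n. real_cost (X n) A < m + 1 / Suc n" by metis
  have dist: "\<mu> / 4 * (\<integral>x. (X i x - X j x)\<^sup>2 \<partial>M) \<le> 1 / Suc i + 1 / Suc j" for i j
  proof -
    let ?v = "\<lambda>x. 1/2 * X i x + (1 - 1/2) * X j x"
    note mid = admissible_convex_combination[OF X(1)[of i] X(1)[of j], of "1/2"]
    let ?a = "state A (X i) - yd" and ?b = "state A (X j) - yd"
    have "state A ?v = (1/2) *\<^sub>R state A (X i) + (1 - 1/2) *\<^sub>R state A (X j)"
      by (intro state_linear admissibleD X A)
    hence "state A ?v - yd = (1/2) *\<^sub>R state A (X i) + (1/2) *\<^sub>R state A (X j)
        - ((1/2) *\<^sub>R yd + (1/2) *\<^sub>R yd)"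
      by (simp flip: scaleR_add_left)
    hence "state A ?v - yd = (1/2) *\<^sub>R (?a + ?b)"
      by (simp add: scaleR_add_right scaleR_diff_right)
    hence "(norm (state A ?v - yd))\<^sup>2 = 1/4 * (norm (?a + ?b))\<^sup>2"
      by (simp add: power_divide)
    also have "\<dots> \<le> 1/2 * (norm ?a)\<^sup>2 + 1/2 * (norm ?b)\<^sup>2"
      using zero_le_power2[of "norm (?a - ?b)"]
      by (simp add: power2_norm_eq_inner inner_commute algebra_simps)
    finally have "\<mu> / 8 * (\<integral>x. (X i x - X j x)\<^sup>2 \<partial>M) + real_cost ?v A \<le> real_cost (X i) A / 2 + real_cost (X j) A / 2"
      using mid(2) by (simp add: real_cost_def add_divide_distrib)
    moreover have "m \<le> real_cost ?v A" using mid(1) by (intro m_le) auto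
    ultimately show ?thesis using X(2)[of i] X(2)[of j] by linarith
  qed
  have "\<exists>N. \<forall>i\<ge>N. \<forall>j\<ge>N. (\<integral>x. (X i x - X j x)\<^sup>2 \<partial>M) < e" if "0 < e" for e
  proof -
    have "0 < \<mu> / 8 * e" using mu_pos \<open>0 < e\<close> by simp
    then obtain N :: nat where N: "1 / Suc N < \<mu> / 8 * e" using nat_approx_posE by blast
    have "(\<integral>x. (X i x - X j x)\<^sup>2 \<partial>M) < e" if "i \<ge> N" "j \<ge> N" for i j
    proof -
      have "1 / real (Suc i) \<le> 1 / Suc N" "1 / real (Suc j) \<le> 1 / Suc N"
        using that by (auto simp: field_simps)
      hence "\<mu> / 4 * (\<integral>x. (X i x - X j x)\<^sup>2 \<partial>M) < \<mu> / 4 * e" using dist[of i j] N by linarith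
      thus ?thesis using mu_pos by simp
    qed
    thus ?thesis by blast
  qed
  from L2_complete[OF admissibleD(1)[OF X(1)] this] obtain r u where r: "strict_mono r" and u: "u \<in> Lp 2 M"
    and ae: "AE x in M. (\<lambda>n. X (r n) x) \<longlonglongrightarrow> u x"
    and lim: "(\<lambda>n. \<integral>x. (X (r n) x - u x)\<^sup>2 \<partial>M) \<longlonglongrightarrow> 0" by blast
  define c where "c n = m + 1 / Suc (r n) - 1 / 2 * (norm (state A (X (r n)) - yd))\<^sup>2 - b" for n
  have state: "(\<lambda>n. state A (X (r n))) \<longlonglongrightarrow> state A u"
    by (rule state_tendsto[OF admissibleD(1)[OF X(1)] u A lim])
  have "(\<lambda>n. 1 / real (Suc n)) \<longlonglongrightarrow> 0"
    using LIMSEQ_inverse_real_of_nat by (simp add: inverse_eq_divide)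
  from LIMSEQ_subseq_LIMSEQ[OF this r] have "(\<lambda>n. 1 / real (Suc (r n))) \<longlonglongrightarrow> 0"
    by (simp add: o_def)
  hence c: "c \<longlonglongrightarrow> m + 0 - 1 / 2 * (norm (state A u - yd))\<^sup>2 - b"
    unfolding c_def by (intro tendsto_intros state)
  have le: "(\<integral>x. gr (X (r n) x) \<partial>M) \<le> c n" for n
    using X(2)[of "r n"] by (simp add: c_def real_cost_def b_def)
  note lsc = integral_gr_lsc[OF X(1) u ae le c]
  have "real_cost u A \<le> m" using lsc(2) by (simp add: real_cost_def b_def)
  hence "real_cost u A \<le> real_cost v A" if "v \<in> admissible" for v using m_le[OF that] by linarith
  thus ?thesis using lsc(1) by blast
qed

text \<open>Since inadmissible controls have infinite cost, the minimum over all of \<open>L\<^sup>2\<close> is the minimum over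
  the admissible ones.\<close>

lemma min_cost_eq:
  assumes A: "A \<in> sets M" and u: "u \<in> admissible" "\<And>v. v \<in> admissible \<Longrightarrow> real_cost u A \<le> real_cost v A"
  shows "min_cost A = ereal (real_cost u A)"
  unfolding min_cost_def
proof (rule Least_equality)
  show "\<exists>v\<in>Lp 2 M. ereal (real_cost u A) = cost v A"
    using u(1) admissibleD(1)[OF u(1)] A by (intro bexI[of _ u]) (simp_all add: cost_eq)
  fix m assume "\<exists>v\<in>Lp 2 M. m = cost v A"
  thus "ereal (real_cost u A) \<le> m" using A u(2) by (auto simp: cost_eq)
qed

end

section \<open>First-order expansion of the minimal cost\<close>

lemma half_norm_add:
  fixes a d :: "'z::real_inner"
  shows "1 / 2 * (norm (a + d))\<^sup>2 = 1 / 2 * (norm a)\<^sup>2 + d \<bullet> a + 1 / 2 * (norm d)\<^sup>2"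
  by (simp add: power2_norm_eq_inner inner_commute algebra_simps)

context control_problem
begin

lemma inner_state:
  assumes "u \<in> Lp 2 M" "A \<in> sets M"
  shows "state A u \<bullet> y = (\<integral>x. indicator A x * u x * S_adj y x \<partial>M)"
  using S_adjoint L2_indicator[OF assms] by (auto simp: is_L2_adjoint_def state_def)

lemma S_adj_L2: "S_adj y \<in> Lp 2 M"
  using S_adjoint by (simp add: is_L2_adjoint_def)

text \<open>First-order optimality: the smooth quadratic part is linearized at the minimizer, while the convex
  part is kept as a difference. Follows from minimality along the segment to \<open>v\<close>, divided by its
  parameter.\<close>

lemma minimizer_variational_inequality:
  assumes A: "A \<in> sets M" and u: "u \<in> admissible" "\<And>v. v \<in> admissible \<Longrightarrow> real_cost u A \<le> real_cost v A" and v: "v \<in> admissible"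
  shows "state A u \<bullet> (state A u - yd) + (\<integral>x. gr (u x) \<partial>M) \<le> state A v \<bullet> (state A u - yd) + (\<integral>x. gr (v x) \<partial>M)"
proof -
  define a where "a = state A u - yd"
  define d where "d = state A v - state A u"
  define D where "D = d \<bullet> a + (\<integral>x. gr (v x) \<partial>M) - (\<integral>x. gr (u x) \<partial>M)"
  have ge: "0 \<le> D + t / 2 * (norm d)\<^sup>2" if t: "0 < t" "t < 1" for t
  proof -
    let ?v = "\<lambda>x. t * v x + (1 - t) * u x"
    note conv = admissible_convex_combination[OF v u(1) t]
    have nn: "0 \<le> \<mu> / 2 * t * (1 - t) * (\<integral>x. (v x - u x)\<^sup>2 \<partial>M)" using mu_pos t by simp
    have "state A ?v - yd = a + t *\<^sub>R d"
      using state_linear[OF admissibleD(1)[OF v] admissibleD(1)[OF u(1)] A, of t "1 - t"]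
      by (simp add: a_def d_def algebra_simps)
    hence norm: "1 / 2 * (norm (state A ?v - yd))\<^sup>2 = 1 / 2 * (norm a)\<^sup>2 + t * (d \<bullet> a) + t\<^sup>2 / 2 * (norm d)\<^sup>2"
      by (simp only: half_norm_add) (simp add: power_mult_distrib)
    have gr: "(\<integral>x. gr (?v x) \<partial>M) \<le> t * (\<integral>x. gr (v x) \<partial>M) + (1 - t) * (\<integral>x. gr (u x) \<partial>M)"
      using conv(2) nn by linarith
    have "0 \<le> real_cost ?v A - real_cost u A" using u(2)[OF conv(1)] by simp
    also have "\<dots> = t * (d \<bullet> a) + t\<^sup>2 / 2 * (norm d)\<^sup>2 + (\<integral>x. gr (?v x) \<partial>M) - (\<integral>x. gr (u x) \<partial>M)"
      unfolding real_cost_def norm by (simp add: a_def)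
    also have "\<dots> \<le> t * (D + t / 2 * (norm d)\<^sup>2)"
      using gr by (simp add: D_def algebra_simps power2_eq_square)
    finally show ?thesis using t by (simp add: zero_le_mult_iff)
  qed
  have "((\<lambda>t. D + t / 2 * (norm d)\<^sup>2) \<longlongrightarrow> D + 0 / 2 * (norm d)\<^sup>2) (at_right 0)"
    by (intro tendsto_intros) auto
  moreover have "eventually (\<lambda>t. 0 \<le> D + t / 2 * (norm d)\<^sup>2) (at_right (0::real))"
    using ge by (auto simp: eventually_at_right_field intro!: exI[of _ 1])
  ultimately have "0 \<le> D + 0 / 2 * (norm d)\<^sup>2" by (intro tendsto_lowerbound) auto
  thus ?thesis by (simp add: D_def a_def d_def inner_diff_left)
qed

lemma tilt_argmin_control:
  assumes p: "p \<in> Lp 2 M"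
  shows "(\<lambda>x. tilt_argmin (p x)) \<in> admissible"
proof -
  have [measurable]: "p \<in> borel_measurable M" using p by (rule Lp_measurable)
  have "(\<lambda>x. tilt_argmin (p x)) \<in> Lp 2 M"
    using abs_tilt_argmin_le mu_pos by (intro L2_dominated[OF p, of _ "1 / \<mu>"]) (auto simp: abs_mult)
  moreover have "integrable M (\<lambda>x. gr (tilt_argmin (p x)))"
  proof (rule Bochner_Integration.integrable_bound[where f="\<lambda>x. (p x)\<^sup>2 / \<mu>"])
    show "AE x in M. norm (gr (tilt_argmin (p x))) \<le> norm ((p x)\<^sup>2 / \<mu>)"
      using gr_tilt_argmin_le gr_nonneg mu_pos by simp
  qed (use p in \<open>auto simp: mem_L2_iff\<close>)
  ultimately show ?thesis using tilt_argmin_in_edom by (simp add: admissible_def)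
qed

lemma admissible_indicator:
  assumes u: "u \<in> admissible" and A: "A \<in> sets M"
  shows "(\<lambda>x. indicator A x * u x) \<in> admissible"
    "(\<integral>x. gr (indicator A x * u x) \<partial>M) = (\<integral>x. indicator A x * gr (u x) \<partial>M)"
proof -
  have eq: "gr (indicator A x * u x) = indicator A x * gr (u x)" for x
    by (simp add: indicator_def)
  show "(\<integral>x. gr (indicator A x * u x) \<partial>M) = (\<integral>x. indicator A x * gr (u x) \<partial>M)"
    by (simp add: eq)
  have "AE x in M. indicator A x * u x \<in> edom g"
    using admissibleD(2)[OF u] by eventually_elim (simp add: indicator_def)
  thus "(\<lambda>x. indicator A x * u x) \<in> admissible"
    using L2_indicator[OF admissibleD(1)[OF u] A] integrable_mult_indicator[OF A admissibleD(3)[OF u]]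
    by (simp add: admissible_def eq)
qed

text \<open>Integrated form of the quadratic growth at the pointwise minimizer. The quadratic term forces a
  control that attains the minimum to agree with \<open>w\<close> almost everywhere on \<open>A\<close>.\<close>

lemma pointwise_optimality:
  assumes u: "u \<in> admissible" and p: "p \<in> Lp 2 M" and A: "A \<in> sets M"
  defines "w \<equiv> \<lambda>x. tilt_argmin (p x)"
  shows "(\<integral>x. indicator A x * (w x * p x + gr (w x)) \<partial>M)
        + \<mu> / 2 * (\<integral>x. (indicator A x * (u x - w x))\<^sup>2 \<partial>M)
      \<le> (\<integral>x. indicator A x * u x * p x \<partial>M) + (\<integral>x. gr (u x) \<partial>M)"
proof -
  have w: "w \<in> admissible" unfolding w_def by (rule tilt_argmin_control[OF p])
  have i1: "integrable M (\<lambda>x. indicator A x * (w x * p x + gr (w x)))"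
    using integrable_mult_indicator[OF A, of "\<lambda>x. w x * p x + gr (w x)"]
      L2_mult_integrable[OF admissibleD(1)[OF w] p] admissibleD(3)[OF w] by simp
  have i2: "integrable M (\<lambda>x. (indicator A x * (u x - w x))\<^sup>2)"
    using L2_indicator[OF L2_diff[OF admissibleD(1)[OF u] admissibleD(1)[OF w]] A] by (simp add: mem_L2_iff)
  have i3: "integrable M (\<lambda>x. indicator A x * u x * p x)"
    using L2_mult_integrable[OF L2_indicator[OF admissibleD(1)[OF u] A] p] .
  have "(\<integral>x. indicator A x * (w x * p x + gr (w x)) + \<mu> / 2 * (indicator A x * (u x - w x))\<^sup>2 \<partial>M)
      \<le> (\<integral>x. indicator A x * u x * p x + gr (u x) \<partial>M)"
  proof (rule integral_mono_AE)
    show "AE x in M. indicator A x * (w x * p x + gr (w x)) + \<mu> / 2 * (indicator A x * (u x - w x))\<^sup>2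
        \<le> indicator A x * u x * p x + gr (u x)"
      using admissibleD(2)[OF u]
    proof eventually_elim
      case (elim x)
      show ?case
        using tilt_argmin_quadratic_growth[OF elim, of "p x"] gr_nonneg[of "u x"]
        by (cases "x \<in> A") (simp_all add: w_def)
    qed
  qed (use i1 i2 i3 admissibleD(3)[OF u] in auto)
  thus ?thesis using i1 i2 i3 admissibleD(3)[OF u] by simp
qed

text \<open>Here \<open>w\<close> is the pointwise minimizer for the adjoint state \<open>p\<close> of \<open>B\<close>, taken on the whole domain,
  and \<open>F = w * p + g w + \<beta>\<close>; the optimal control of \<open>B\<close> is \<open>w\<close> restricted to \<open>B\<close>. The lower bound for
  \<open>A\<close> holds because the quadratic term lies above its linearization at the state of \<open>B\<close>, and the
  linearized problem on \<open>A\<close> is minimized pointwise by \<open>w\<close>. The upper bound is the cost of the control \<open>w\<close> restricted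
  to \<open>A\<close>, for which the linearization is off by half the squared norm of the change of the state.\<close>

theorem min_cost_first_order_expansion:
  assumes B: "B \<in> sets M"
  shows "\<exists>w F j. w \<in> Lp 2 M \<and> integrable M F \<and> (\<forall>A\<in>sets M. min_cost A = ereal (j A) \<and>
      (\<integral>x. (indicator A x - indicator B x) * F x \<partial>M) \<le> j A - j B \<and>
      j A - j B \<le> (\<integral>x. (indicator A x - indicator B x) * F x \<partial>M)
        + 1 / 2 * (norm (S (\<lambda>x. (indicator A x - indicator B x) * w x)))\<^sup>2)"
proof -
  have "\<exists>U. \<forall>A\<in>sets M. U A \<in> admissible \<and> (\<forall>v\<in>admissible. real_cost (U A) A \<le> real_cost v A)"
    using ex_minimizer by (intro bchoice) blast
  then obtain U where U: "\<And>A. A \<in> sets M \<Longrightarrow> U A \<in> admissible"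
      "\<And>A v. A \<in> sets M \<Longrightarrow> v \<in> admissible \<Longrightarrow> real_cost (U A) A \<le> real_cost v A" by blast
  define j where "j A = real_cost (U A) A" for A
  have min_cost: "min_cost A = ereal (j A)" if "A \<in> sets M" for A
    unfolding j_def using U that by (intro min_cost_eq) auto
  define a where "a = state B (U B) - yd"
  define p where "p = S_adj a"
  define w where "w = (\<lambda>x. tilt_argmin (p x))"
  define H where "H = (\<lambda>x. w x * p x + gr (w x))"
  have p: "p \<in> Lp 2 M" unfolding p_def by (rule S_adj_L2)
  have w: "w \<in> admissible" unfolding w_def by (rule tilt_argmin_control[OF p])
  have inner: "state A u \<bullet> a = (\<integral>x. indicator A x * u x * p x \<partial>M)" if "u \<in> admissible" "A \<in> sets M" for u A
    using inner_state[OF admissibleD(1)[OF that(1)] that(2)] by (simp add: p_def)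
  have wp: "integrable M (\<lambda>x. w x * p x)" by (rule L2_mult_integrable[OF admissibleD(1)[OF w] p])
  have int: "integrable M (\<lambda>x. indicator A x * f x)" if "A \<in> sets M" "integrable M f" for A and f :: "'a \<Rightarrow> real"
    using integrable_mult_indicator[OF that] by simp
  have H: "integrable M H" unfolding H_def using wp admissibleD(3)[OF w] by simp
  have H_split: "(\<integral>x. indicator A x * H x \<partial>M) = state A w \<bullet> a + (\<integral>x. indicator A x * gr (w x) \<partial>M)"
    if A: "A \<in> sets M" for A
  proof -
    have "(\<integral>x. indicator A x * H x \<partial>M)
        = (\<integral>x. indicator A x * (w x * p x) + indicator A x * gr (w x) \<partial>M)"
      by (simp add: H_def algebra_simps)
    also have "\<dots> = (\<integral>x. indicator A x * (w x * p x) \<partial>M) + (\<integral>x. indicator A x * gr (w x) \<partial>M)"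
      using int[OF A wp] int[OF A admissibleD(3)[OF w]] by simp
    finally show ?thesis using inner[OF w A] by (simp add: mult.assoc)
  qed
  have state_idem: "state A (\<lambda>x. indicator A x * w x) = state A w" for A
    by (simp add: state_def mult.assoc[symmetric] flip: indicator_inter_arith)
  have lower: "(\<integral>x. indicator A x * H x \<partial>M) + \<mu> / 2 * (\<integral>x. (indicator A x * (u x - w x))\<^sup>2 \<partial>M)
      \<le> state A u \<bullet> a + (\<integral>x. gr (u x) \<partial>M)" if "u \<in> admissible" "A \<in> sets M" for u A
    using pointwise_optimality[OF that(1) p that(2)] inner[OF that] by (simp add: w_def H_def)
  \<comment> \<open>The variational inequality, tested with the restriction of \<open>w\<close> to \<open>B\<close>, is the reverse of \<open>lower\<close>;
      hence the optimal control of \<open>B\<close> agrees with \<open>w\<close> on \<open>B\<close>.\<close>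
  have "state B (U B) \<bullet> a + (\<integral>x. gr (U B x) \<partial>M) \<le> state B w \<bullet> a + (\<integral>x. indicator B x * gr (w x) \<partial>M)"
    using minimizer_variational_inequality[OF B U(1)[OF B] U(2)[OF B] admissible_indicator(1)[OF w B]]
    by (simp add: a_def state_idem admissible_indicator(2)[OF w B])
  hence opt: "state B (U B) \<bullet> a + (\<integral>x. gr (U B x) \<partial>M) \<le> (\<integral>x. indicator B x * H x \<partial>M)"
    by (simp add: H_split[OF B])
  have "\<mu> / 2 * (\<integral>x. (indicator B x * (U B x - w x))\<^sup>2 \<partial>M) \<le> 0"
    using lower[OF U(1)[OF B] B] opt by linarith
  hence "(\<integral>x. (indicator B x * (U B x - w x))\<^sup>2 \<partial>M) \<le> 0"
    using mu_pos by (simp add: mult_le_0_iff)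
  hence zero: "(\<integral>x. (indicator B x * (U B x - w x))\<^sup>2 \<partial>M) = 0"
    by (intro antisym) auto
  have state_B: "state B (U B) = state B w"
  proof -
    obtain C where C: "\<And>u. u \<in> Lp 2 M \<Longrightarrow> norm (S u) \<le> C * sqrt (\<integral>x. (u x)\<^sup>2 \<partial>M)"
      using S_bound by blast
    have "norm (S (\<lambda>x. indicator B x * (U B x - w x))) \<le> 0"
      using C[OF L2_indicator[OF L2_diff[OF admissibleD(1)[OF U(1)[OF B]] admissibleD(1)[OF w]] B]] zero by simp
    moreover have "S (\<lambda>x. indicator B x * (U B x - w x)) = state B (U B) - state B w"
      using state_linear[OF admissibleD(1)[OF U(1)[OF B]] admissibleD(1)[OF w] B, of 1 "-1"] by (simp add: state_def)
    ultimately show ?thesis by simp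
  qed
  have grB: "(\<integral>x. gr (U B x) \<partial>M) = (\<integral>x. indicator B x * gr (w x) \<partial>M)"
    using opt lower[OF U(1)[OF B] B] zero by (simp add: H_split[OF B] state_B)
  have jB: "j B = 1 / 2 * (norm a)\<^sup>2 + (\<integral>x. indicator B x * gr (w x) \<partial>M) + (\<integral>x. indicator B x * \<beta> x \<partial>M)"
    by (simp add: j_def real_cost_def grB a_def)
  define F where "F = (\<lambda>x. H x + \<beta> x)"
  have F: "integrable M F" unfolding F_def using H beta_L1 by simp
  have F_split: "(\<integral>x. (indicator A x - indicator B x) * F x \<partial>M)
      = (\<integral>x. indicator A x * H x \<partial>M) + (\<integral>x. indicator A x * \<beta> x \<partial>M)
      - (\<integral>x. indicator B x * H x \<partial>M) - (\<integral>x. indicator B x * \<beta> x \<partial>M)" if A: "A \<in> sets M" for A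
  proof -
    have "(\<integral>x. (indicator A x - indicator B x) * F x \<partial>M)
        = (\<integral>x. indicator A x * H x + indicator A x * \<beta> x
            - indicator B x * H x - indicator B x * \<beta> x \<partial>M)"
      by (simp add: F_def algebra_simps)
    thus ?thesis using int[OF A H] int[OF A beta_L1] int[OF B H] int[OF B beta_L1] by simp
  qed
  have yB: "state B w - yd = a" by (simp add: a_def state_B)
  show ?thesis
  proof (intro exI conjI ballI, rule admissibleD(1)[OF w], rule F, rule min_cost, assumption)
    fix A assume A: "A \<in> sets M"
    show "(\<integral>x. (indicator A x - indicator B x) * F x \<partial>M) \<le> j A - j B"
    proof -
      let ?d = "state A (U A) - state B w"
      have "state A (U A) - yd = a + ?d" using yB by (simp add: algebra_simps)
      hence "1 / 2 * (norm (state A (U A) - yd))\<^sup>2 \<ge> 1 / 2 * (norm a)\<^sup>2 + ?d \<bullet> a"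
        by (simp only: half_norm_add) simp
      hence "1 / 2 * (norm a)\<^sup>2 + state A (U A) \<bullet> a - state B w \<bullet> a + (\<integral>x. gr (U A x) \<partial>M)
          + (\<integral>x. indicator A x * \<beta> x \<partial>M) \<le> j A"
        by (simp add: j_def real_cost_def inner_diff_left)
      moreover have "(\<integral>x. indicator A x * H x \<partial>M) \<le> state A (U A) \<bullet> a + (\<integral>x. gr (U A x) \<partial>M)"
      proof -
        have "0 \<le> \<mu> / 2 * (\<integral>x. (indicator A x * (U A x - w x))\<^sup>2 \<partial>M)" using mu_pos by simp
        thus ?thesis using lower[OF U(1)[OF A] A] by linarith
      qed
      ultimately show ?thesis unfolding F_split[OF A] jB H_split[OF B] by linarith
    qed
    show "j A - j B \<le> (\<integral>x. (indicator A x - indicator B x) * F x \<partial>M)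
        + 1 / 2 * (norm (S (\<lambda>x. (indicator A x - indicator B x) * w x)))\<^sup>2"
    proof -
      let ?d = "S (\<lambda>x. (indicator A x - indicator B x) * w x)"
      have d: "?d = state A w - state B w"
        using S_diff[OF L2_indicator[OF admissibleD(1)[OF w] A] L2_indicator[OF admissibleD(1)[OF w] B]]
        by (simp add: state_def algebra_simps)
      have "state A w - yd = a + ?d" unfolding d using yB by (simp add: algebra_simps)
      hence norm: "1 / 2 * (norm (state A w - yd))\<^sup>2 = 1 / 2 * (norm a)\<^sup>2 + ?d \<bullet> a + 1 / 2 * (norm ?d)\<^sup>2"
        by (simp only: half_norm_add)
      have "j A \<le> real_cost (\<lambda>x. indicator A x * w x) A"
        unfolding j_def by (rule U(2)[OF A admissible_indicator(1)[OF w A]])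
      also have "\<dots> = 1 / 2 * (norm a)\<^sup>2 + ?d \<bullet> a + 1 / 2 * (norm ?d)\<^sup>2
          + (\<integral>x. indicator A x * gr (w x) \<partial>M) + (\<integral>x. indicator A x * \<beta> x \<partial>M)"
        unfolding real_cost_def state_idem norm admissible_indicator(2)[OF w A] by simp
      finally show ?thesis
        unfolding F_split[OF A] jB H_split[OF B] H_split[OF A] d by (simp add: inner_diff_left)
    qed
  qed
qed

end

section \<open>The remainder on small sets\<close>

text \<open>Stands in for Hoelder's inequality: integrated over a small set \<open>D\<close>, the constant contributes
  \<open>s\<^sup>2\<close> times the measure of \<open>D\<close>, and the \<open>q\<close>-th power is controlled by the \<open>L\<^sup>q\<close> norm on the
  whole space.\<close>

lemma square_le_truncated_powr:
  fixes s z q :: real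
  assumes s: "0 < s" and q: "2 < q"
  shows "z\<^sup>2 \<le> s\<^sup>2 + s powr (2 - q) * \<bar>z\<bar> powr q"
proof (cases "\<bar>z\<bar> \<le> s")
  case True
  hence "z\<^sup>2 \<le> s\<^sup>2" using power_mono[OF True abs_ge_zero, of 2] by simp
  moreover have "0 \<le> s powr (2 - q) * \<bar>z\<bar> powr q" by simp
  ultimately show ?thesis by linarith
next
  case False
  have "s powr (2 - q) * s powr (q - 2) = 1" using s by (simp flip: powr_add)
  moreover have "s powr (q - 2) \<le> \<bar>z\<bar> powr (q - 2)" using False s q by (intro powr_mono2) auto
  ultimately have "1 \<le> s powr (2 - q) * \<bar>z\<bar> powr (q - 2)"
    by (metis mult_left_mono powr_ge_zero)
  hence "z\<^sup>2 * 1 \<le> z\<^sup>2 * (s powr (2 - q) * \<bar>z\<bar> powr (q - 2))" by (intro mult_left_mono) auto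
  also have "\<dots> = s powr (2 - q) * \<bar>z\<bar> powr q"
  proof -
    have "\<bar>z\<bar> powr q = \<bar>z\<bar> powr 2 * \<bar>z\<bar> powr (q - 2)"
      using powr_add[of "\<bar>z\<bar>" 2 "q - 2"] by simp
    moreover have "\<bar>z\<bar> powr 2 = z\<^sup>2" using False s by (simp add: powr_numeral)
    ultimately show ?thesis by simp
  qed
  finally have "z\<^sup>2 \<le> s powr (2 - q) * \<bar>z\<bar> powr q" by simp
  moreover have "0 \<le> s\<^sup>2" by simp
  ultimately show ?thesis by linarith
qed

context control_problem
begin

text \<open>Write the square of the norm as the integral of \<open>v\<close> against \<open>z = S_adj (S v)\<close>, split the product by
  Young's inequality with weight \<open>\<epsilon>\<close>, and use on \<open>D\<close> that \<open>z\<close> is bounded in \<open>L\<^sup>q\<close> by the \<open>L\<^sup>2\<close> norm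
  of \<open>v\<close>.\<close>

lemma norm_S_localized_bound:
  assumes q: "2 < q" and SS: "bounded_linear_Lp_Lq 2 q M (\<lambda>u. S_adj (S u))"
  obtains C where "0 \<le> C" "\<And>v D \<epsilon>. v \<in> Lp 2 M \<Longrightarrow> D \<in> sets M \<Longrightarrow> (\<And>x. x \<notin> D \<Longrightarrow> v x = 0) \<Longrightarrow> 0 < \<epsilon> \<Longrightarrow>
     (norm (S v))\<^sup>2 \<le> \<epsilon> / 2 * (\<integral>x. (v x)\<^sup>2 \<partial>M)
       + 1 / (2 * \<epsilon>) * (\<epsilon>\<^sup>2 * measure M D + \<epsilon> powr (2 - q) * (C * sqrt (\<integral>x. (v x)\<^sup>2 \<partial>M)) powr q)"
proof -
  obtain C0 where C0: "\<And>u. u \<in> Lp 2 M \<Longrightarrow> Lp_norm q M (S_adj (S u)) \<le> C0 * sqrt (\<integral>x. (u x)\<^sup>2 \<partial>M)"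
    using SS unfolding bounded_linear_Lp_Lq_def L2_norm_eq by blast
  have Lq: "S_adj (S u) \<in> Lp q M" if "u \<in> Lp 2 M" for u
    using SS that unfolding bounded_linear_Lp_Lq_def by blast
  show ?thesis
  proof (rule that[of "\<bar>C0\<bar>"])
    fix v D and \<epsilon> :: real
    assume v: "v \<in> Lp 2 M" and D: "D \<in> sets M" and off: "\<And>x. x \<notin> D \<Longrightarrow> v x = 0" and \<epsilon>: "0 < \<epsilon>"
    define z where "z = S_adj (S v)"
    define I where "I = (\<integral>x. \<bar>z x\<bar> powr q \<partial>M)"
    let ?V = "\<integral>x. (v x)\<^sup>2 \<partial>M"
    have zq: "integrable M (\<lambda>x. \<bar>z x\<bar> powr q)" using Lq[OF v] by (simp add: z_def Lp_def)
    have "0 \<le> I" unfolding I_def by simp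
    have "I powr (1 / q) \<le> C0 * sqrt ?V" using C0[OF v] by (simp add: Lp_norm_def z_def I_def)
    also have "\<dots> \<le> \<bar>C0\<bar> * sqrt ?V" by (intro mult_right_mono) auto
    finally have "(I powr (1 / q)) powr q \<le> (\<bar>C0\<bar> * sqrt ?V) powr q"
      using q by (intro powr_mono2) auto
    hence I: "I \<le> (\<bar>C0\<bar> * sqrt ?V) powr q" using q \<open>0 \<le> I\<close> by (simp add: powr_powr)
    have "z \<in> Lp 2 M" and inner: "S v \<bullet> S v = (\<integral>x. v x * z x \<partial>M)"
      using S_adjoint v by (auto simp: is_L2_adjoint_def z_def)
    have iD: "integrable M (indicat_real D)"
      using D by (intro integrable_real_indicator) (auto simp: less_top[symmetric])
    have iv: "integrable M (\<lambda>x. (v x)\<^sup>2)" using v by (simp add: mem_L2_iff)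
    have "(norm (S v))\<^sup>2 = (\<integral>x. v x * z x \<partial>M)" by (simp add: power2_norm_eq_inner inner)
    also have "\<dots> \<le> (\<integral>x. \<epsilon> / 2 * (v x)\<^sup>2
        + 1 / (2 * \<epsilon>) * (\<epsilon>\<^sup>2 * indicator D x + \<epsilon> powr (2 - q) * \<bar>z x\<bar> powr q) \<partial>M)"
    proof (rule integral_mono)
      fix x
      show "v x * z x \<le> \<epsilon> / 2 * (v x)\<^sup>2
          + 1 / (2 * \<epsilon>) * (\<epsilon>\<^sup>2 * indicator D x + \<epsilon> powr (2 - q) * \<bar>z x\<bar> powr q)"
      proof (cases "x \<in> D")
        case True
        have "0 \<le> (\<epsilon> * v x - z x)\<^sup>2 / (2 * \<epsilon>)" using \<epsilon> by simp
        also have "\<dots> = \<epsilon> / 2 * (v x)\<^sup>2 + 1 / (2 * \<epsilon>) * (z x)\<^sup>2 - v x * z x"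
          using \<epsilon> by (simp add: power2_eq_square field_simps)
        finally have "v x * z x \<le> \<epsilon> / 2 * (v x)\<^sup>2 + 1 / (2 * \<epsilon>) * (z x)\<^sup>2" by simp
        also have "1 / (2 * \<epsilon>) * (z x)\<^sup>2 \<le> 1 / (2 * \<epsilon>) * (\<epsilon>\<^sup>2 + \<epsilon> powr (2 - q) * \<bar>z x\<bar> powr q)"
          using square_le_truncated_powr[OF \<epsilon> q, of "z x"] \<epsilon> by (intro mult_left_mono) auto
        finally show ?thesis using True by simp
      next
        case False
        thus ?thesis using off[OF False] \<epsilon> by simp
      qed
    qed (use L2_mult_integrable[OF v \<open>z \<in> Lp 2 M\<close>] zq iD iv in auto)
    also have "\<dots> = \<epsilon> / 2 * ?V + 1 / (2 * \<epsilon>) * (\<epsilon>\<^sup>2 * measure M D + \<epsilon> powr (2 - q) * I)"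
      using zq iD iv D by (simp add: I_def)
    also have "\<dots> \<le> \<epsilon> / 2 * ?V + 1 / (2 * \<epsilon>) * (\<epsilon>\<^sup>2 * measure M D + \<epsilon> powr (2 - q) * (\<bar>C0\<bar> * sqrt ?V) powr q)"
      using I \<epsilon> by (intro add_left_mono mult_left_mono) auto
    finally show "(norm (S v))\<^sup>2 \<le> \<dots>" .
  qed simp
qed

text \<open>For controls of bounded mean square that live on sets of measure at most \<open>b\<close>, the \<open>L\<^sup>2\<close> norm
  is at most of order \<open>b\<close> to the power \<open>1/2\<close>, so the last term of the preceding bound is at most of order
  \<open>b\<close> to the power \<open>q / 2\<close>, which is of smaller order than \<open>b\<close> since \<open>q > 2\<close>. The other two terms are at most a
  fixed multiple of \<open>\<epsilon> * b\<close>.\<close>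

lemma norm_S_localized_small:
  fixes v :: "'i \<Rightarrow> 'a \<Rightarrow> real"
  assumes q: "2 < q" and SS: "bounded_linear_Lp_Lq 2 q M (\<lambda>u. S_adj (S u))"
    and b0: "(b \<longlongrightarrow> 0) Fl" and bpos: "eventually (\<lambda>r. 0 < b r) Fl"
    and D: "\<And>r. D r \<in> sets M" "eventually (\<lambda>r. measure M (D r) \<le> b r) Fl"
    and v: "\<And>r. v r \<in> Lp 2 M" "\<And>r x. x \<notin> D r \<Longrightarrow> v r x = 0"
    and bound: "eventually (\<lambda>r. (\<integral>x. (v r x)\<^sup>2 \<partial>M) \<le> k * b r) Fl" and k: "0 \<le> k"
  shows "((\<lambda>r. (norm (S (v r)))\<^sup>2 / b r) \<longlongrightarrow> 0) Fl"
proof -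
  obtain C where C: "0 \<le> C" "\<And>v D \<epsilon>. v \<in> Lp 2 M \<Longrightarrow> D \<in> sets M \<Longrightarrow> (\<And>x. x \<notin> D \<Longrightarrow> v x = 0) \<Longrightarrow> 0 < \<epsilon> \<Longrightarrow>
     (norm (S v))\<^sup>2 \<le> \<epsilon> / 2 * (\<integral>x. (v x)\<^sup>2 \<partial>M)
       + 1 / (2 * \<epsilon>) * (\<epsilon>\<^sup>2 * measure M D + \<epsilon> powr (2 - q) * (C * sqrt (\<integral>x. (v x)\<^sup>2 \<partial>M)) powr q)"
    using norm_S_localized_bound[OF q SS] by metis
  have lim: "((\<lambda>r. b r powr (q / 2 - 1)) \<longlongrightarrow> 0) Fl"
    using bpos q by (intro tendsto_zero_powrI[OF b0 tendsto_const]) (auto elim: eventually_mono)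
  show ?thesis
  proof (rule tendstoI)
    fix e :: real assume e: "0 < e"
    \<comment> \<open>With this weight the first two terms of the bound add up to at most \<open>e / 2 * b r\<close>.\<close>
    define \<epsilon> where "\<epsilon> = e / (k + 1)"
    have \<epsilon>: "0 < \<epsilon>" using e k by (simp add: \<epsilon>_def)
    have \<epsilon>k: "\<epsilon> * (k + 1) = e" using k by (simp add: \<epsilon>_def)
    define L where "L = 1 / (2 * \<epsilon>) * (\<epsilon> powr (2 - q) * (C * sqrt k) powr q)"
    have "((\<lambda>r. L * b r powr (q / 2 - 1)) \<longlongrightarrow> 0) Fl" using tendsto_mult_left[OF lim, of L] by simp
    hence "eventually (\<lambda>r. L * b r powr (q / 2 - 1) < e / 2) Fl"
      using order_tendstoD(2)[of _ 0 Fl "e/2"] e by simp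
    thus "eventually (\<lambda>r. dist ((norm (S (v r)))\<^sup>2 / b r) 0 < e) Fl"
      using bpos D(2) bound
    proof eventually_elim
      case (elim r)
      let ?V = "\<integral>x. (v r x)\<^sup>2 \<partial>M"
      have V0: "0 \<le> ?V" by simp
      have "(C * sqrt ?V) powr q \<le> (C * sqrt k * sqrt (b r)) powr q"
      proof (intro powr_mono2)
        have "sqrt ?V \<le> sqrt k * sqrt (b r)" using elim(4) by (simp flip: real_sqrt_mult)
        from mult_left_mono[OF this C(1)] show "C * sqrt ?V \<le> C * sqrt k * sqrt (b r)"
          by (simp add: mult.assoc)
      qed (use q C(1) in auto)
      also have "\<dots> = (C * sqrt k) powr q * (sqrt (b r)) powr q"
        using C(1) k elim(2) by (simp add: powr_mult)
      also have "(sqrt (b r)) powr q = b r powr (q / 2)"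
        using elim(2) by (simp add: powr_powr flip: powr_half_sqrt)
      also have "\<dots> = b r * b r powr (q / 2 - 1)"
        using elim(2) by (simp add: powr_diff)
      finally have P: "(C * sqrt ?V) powr q \<le> (C * sqrt k) powr q * (b r * b r powr (q / 2 - 1))" .
      have "(norm (S (v r)))\<^sup>2 \<le> \<epsilon> / 2 * ?V
          + 1 / (2 * \<epsilon>) * (\<epsilon>\<^sup>2 * measure M (D r) + \<epsilon> powr (2 - q) * (C * sqrt ?V) powr q)"
        by (rule C(2)[OF v(1) D(1) v(2) \<epsilon>])
      also have "\<dots> \<le> \<epsilon> / 2 * (k * b r) + 1 / (2 * \<epsilon>) * (\<epsilon>\<^sup>2 * b r
          + \<epsilon> powr (2 - q) * ((C * sqrt k) powr q * (b r * b r powr (q / 2 - 1))))"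
        using elim(3,4) \<epsilon> P by (intro add_mono mult_left_mono) auto
      also have "\<dots> = b r * (\<epsilon> / 2 * (k + 1) + L * b r powr (q / 2 - 1))"
        using \<epsilon> by (simp add: L_def field_simps power2_eq_square)
      also have "\<epsilon> / 2 * (k + 1) = e / 2" using \<epsilon>k by simp
      finally have "(norm (S (v r)))\<^sup>2 / b r \<le> e / 2 + L * b r powr (q / 2 - 1)"
        using elim(2) by (simp add: field_simps)
      also have "\<dots> < e" using elim(1) by simp
      finally show ?case using elim(2) by simp
    qed
  qed
qed

end

section \<open>The topological derivative\<close>

lemma measure_ball_tendsto_0:
  "((\<lambda>r. measure lebesgue (ball x r)) \<longlongrightarrow> 0) (at_right 0)" for x :: "'a::euclidean_space"
proof -
  have "((\<lambda>r. unit_ball_vol (real DIM('a)) * r ^ DIM('a)) \<longlongrightarrow> unit_ball_vol (real DIM('a)) * 0 ^ DIM('a)) (at_right 0)"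
    by (intro tendsto_intros)
  moreover have "eventually (\<lambda>r. measure lebesgue (ball x r) = unit_ball_vol (real DIM('a)) * r ^ DIM('a)) (at_right 0)"
    using eventually_at_right_less[of 0]
    by eventually_elim (simp add: content_ball)
  ultimately show ?thesis by (simp add: tendsto_cong zero_power[OF DIM_positive])
qed

lemma eventually_integral_ball_le:
  fixes f :: "'a::euclidean_space \<Rightarrow> real"
  assumes "(ball_average f x \<longlongrightarrow> l) (at_right 0)"
  shows "eventually (\<lambda>r. (\<integral>y. indicator (ball x r) y * f y \<partial>lebesgue)
            \<le> (\<bar>l\<bar> + 1) * measure lebesgue (ball x r)) (at_right 0)"
proof -
  have "l < \<bar>l\<bar> + 1" by linarith
  from order_tendstoD(2)[OF assms this] eventually_at_right_less[of 0]
  show ?thesis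
  proof eventually_elim
    case (elim r)
    thus ?case using content_ball_pos[of r x] by (simp add: ball_average_def divide_simps split: if_splits)
  qed
qed

theorem theorem4p3:
  fixes \<Omega> :: "'a::euclidean_space set"
    and S :: "('a \<Rightarrow> real) \<Rightarrow> 'y::{real_inner, complete_space}"
    and S_adj :: "'y \<Rightarrow> 'a \<Rightarrow> real"
    and y\<^sub>d :: 'y
    and g :: "real \<Rightarrow> ereal"
    and \<beta> :: "'a \<Rightarrow> real"
    and \<mu> q :: real
    and B :: "'a set"
  assumes Omega_meas: "\<Omega> \<in> sets lebesgue"
    and Omega_finite: "emeasure lebesgue \<Omega> < \<infinity>"
    and S_bounded_linear: "bounded_linear_on_Lp 2 (lebesgue_on \<Omega>) S"
    and S_adjoint: "is_L2_adjoint (lebesgue_on \<Omega>) S S_adj"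
    and g_proper: "proper_fun g"
    and g_convex: "econvex g"
    and g_lsc: "lower_semicont g"
    and g_nonneg: "\<And>u. 0 \<le> g u"
    and g_zero_iff: "\<And>u. g u = 0 \<longleftrightarrow> u = 0"
    and mu_pos: "0 < \<mu>"
    and g_strongly_convex:
      "\<And>u v t. u \<in> edom g \<Longrightarrow> v \<in> edom g \<Longrightarrow> t \<in> {0<..<1} \<Longrightarrow>
         ereal (\<mu> / 2 * t * (1 - t) * \<bar>u - v\<bar>\<^sup>2) + g (t * u + (1 - t) * v)
           \<le> ereal t * g u + ereal (1 - t) * g v"
    and q_gt: "6 < q"
    and SS_bounded_linear: "bounded_linear_Lp_Lq 2 q (lebesgue_on \<Omega>) (\<lambda>u. S_adj (S u))"
    and S_adj_yd: "S_adj y\<^sub>d \<in> Lp q (lebesgue_on \<Omega>)"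
    and beta_L1: "integrable (lebesgue_on \<Omega>) \<beta>"
    and B_subset: "B \<subseteq> \<Omega>"
    and B_meas: "B \<in> sets lebesgue"
    and B_optimal:
      "\<And>A. A \<subseteq> \<Omega> \<Longrightarrow> A \<in> sets lebesgue \<Longrightarrow> J_min \<Omega> S y\<^sub>d g \<beta> B \<le> J_min \<Omega> S y\<^sub>d g \<beta> A"
  shows "AE x in lebesgue_on \<Omega>. DJ_exists \<Omega> S y\<^sub>d g \<beta> B x \<and> 0 \<le> DJ \<Omega> S y\<^sub>d g \<beta> B x"
proof -
  let ?M = "lebesgue_on \<Omega>"
  have "\<Omega> \<in> lmeasurable" using Omega_meas Omega_finite by (simp add: fmeasurable_def)
  then interpret finite_measure ?M by (rule finite_measure_lebesgue_on)
  interpret control_problem ?M g \<mu> S S_adj y\<^sub>d \<beta>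
    by unfold_locales
      (fact g_lsc g_nonneg g_zero_iff mu_pos g_strongly_convex S_bounded_linear S_adjoint beta_L1)+
  have J: "J_min \<Omega> S y\<^sub>d g \<beta> A = min_cost A" for A
    by (simp add: J_min_def J_cost_def min_cost_def cost_def)
  have sets_M: "A \<in> sets ?M \<longleftrightarrow> A \<subseteq> \<Omega> \<and> A \<in> sets lebesgue" for A
    using Omega_meas by (simp add: sets_restrict_space_iff)
  have intM: "integrable ?M f \<longleftrightarrow> integrable lebesgue (\<lambda>x. indicator \<Omega> x * f x)"
    and integralM: "(\<integral>x. f x \<partial>?M) = (\<integral>x. indicator \<Omega> x * f x \<partial>lebesgue)" for f :: "'a \<Rightarrow> real"
    using Omega_meas by (simp_all add: integrable_restrict_space integral_restrict_space
        set_integrable_def set_lebesgue_integral_def)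
  have B: "B \<in> sets ?M" using B_subset B_meas by (simp add: sets_M)
  obtain w F j where w: "w \<in> Lp 2 ?M" and F: "integrable ?M F"
    and j: "\<And>A. A \<in> sets ?M \<Longrightarrow> min_cost A = ereal (j A)"
    and lower: "\<And>A. A \<in> sets ?M \<Longrightarrow> (\<integral>x. (indicator A x - indicator B x) * F x \<partial>?M) \<le> j A - j B"
    and upper: "\<And>A. A \<in> sets ?M \<Longrightarrow> j A - j B \<le> (\<integral>x. (indicator A x - indicator B x) * F x \<partial>?M)
        + 1 / 2 * (norm (S (\<lambda>x. (indicator A x - indicator B x) * w x)))\<^sup>2"
    using min_cost_first_order_expansion[OF B] by blast
  \<comment> \<open>The three densities on the whole space to which the differentiation theorem is applied.\<close>
  define W where "W y = indicator \<Omega> y * (w y)\<^sup>2" for y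
  define \<phi> where "\<phi> E y = indicator E y * F y" for E y
  have \<phi>_int: "integrable lebesgue (\<phi> E)" if "E \<subseteq> \<Omega>" "E \<in> sets lebesgue" for E
  proof -
    have "integrable lebesgue (\<lambda>y. indicator E y *\<^sub>R (indicator \<Omega> y * F y))"
      using F that(2) by (intro integrable_mult_indicator) (simp_all add: intM)
    moreover have "indicator E y *\<^sub>R (indicator \<Omega> y * F y) = \<phi> E y" for y
      using that(1) by (auto simp: \<phi>_def indicator_def)
    ultimately show ?thesis by simp
  qed
  have W_int: "integrable lebesgue W"
    using w by (simp add: mem_L2_iff intM W_def[abs_def])
  have "AE x in lebesgue. (ball_average (\<phi> B) x \<longlongrightarrow> \<phi> B x) (at_right 0)"
    by (intro lebesgue_differentiation_balls \<phi>_int B_subset B_meas)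
  moreover have "AE x in lebesgue. (ball_average (\<phi> (\<Omega> - B)) x \<longlongrightarrow> \<phi> (\<Omega> - B) x) (at_right 0)"
    using Omega_meas B_meas by (intro lebesgue_differentiation_balls \<phi>_int) auto
  moreover have "AE x in lebesgue. (ball_average W x \<longlongrightarrow> W x) (at_right 0)"
    by (intro lebesgue_differentiation_balls W_int)
  ultimately have "AE x in lebesgue. x \<in> \<Omega> \<longrightarrow> DJ_exists \<Omega> S y\<^sub>d g \<beta> B x \<and> 0 \<le> DJ \<Omega> S y\<^sub>d g \<beta> B x"
  proof (eventually_elim, intro impI)
    fix x
    assume avg_in: "(ball_average (\<phi> B) x \<longlongrightarrow> \<phi> B x) (at_right 0)"
      and avg_out: "(ball_average (\<phi> (\<Omega> - B)) x \<longlongrightarrow> \<phi> (\<Omega> - B) x) (at_right 0)"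
      and avg_W: "(ball_average W x \<longlongrightarrow> W x) (at_right 0)" and x: "x \<in> \<Omega>"
    define b where "b r = measure lebesgue (ball x r)" for r
    define A where "A r = (if x \<in> B then B - ball x r else (B \<union> ball x r) \<inter> \<Omega>)" for r
    \<comment> \<open>Inside \<open>B\<close> the ball is removed and outside it is added, so that the two characteristic functions
        differ by \<open>\<sigma>\<close> times that of the part of the ball in \<open>E\<close>.\<close>
    define E where "E = (if x \<in> B then B else \<Omega> - B)"
    define \<sigma> :: real where "\<sigma> = (if x \<in> B then -1 else 1)"
    define v where "v r y = (indicator (A r) y - indicator B y) * w y" for r y
    define Q where "Q r = (j (A r) - j B) / b r" for r
    have A: "A r \<in> sets ?M" for r
      using B_subset B_meas Omega_meas by (auto simp: sets_M A_def intro!: sets.Int sets.Un sets.Diff)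
    have diff: "indicator (A r) y - indicator B y = \<sigma> * (indicator (ball x r) y * indicator E y)" if "y \<in> \<Omega>" for r y
      using that B_subset by (auto simp: A_def \<sigma>_def E_def indicator_def)
    have E: "E \<subseteq> \<Omega>" using B_subset by (auto simp: E_def)
    have first_order: "(\<integral>y. (indicator (A r) y - indicator B y) * F y \<partial>?M) = \<sigma> * (\<integral>y. indicator (ball x r) y * \<phi> E y \<partial>lebesgue)" for r
    proof -
      have "(\<integral>y. (indicator (A r) y - indicator B y) * F y \<partial>?M)
          = (\<integral>y. \<sigma> * (indicator (ball x r) y * \<phi> E y) \<partial>lebesgue)"
        unfolding integralM
      proof (intro Bochner_Integration.integral_cong refl)
        fix y
        show "indicator \<Omega> y * ((indicator (A r) y - indicator B y) * F y)
            = \<sigma> * (indicator (ball x r) y * \<phi> E y)"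
          using diff[of y r] E by (cases "y \<in> \<Omega>") (auto simp: \<phi>_def indicator_def)
      qed
      thus ?thesis by simp
    qed
    have ball_Omega: "ball x r \<inter> \<Omega> \<in> sets lebesgue" for r
      using Omega_meas by (intro sets.Int) auto
    have bpos: "eventually (\<lambda>r. 0 < b r) (at_right 0)"
      using eventually_at_right_less[of 0] by eventually_elim (simp add: b_def content_ball_pos)
    have avg: "((\<lambda>r. \<sigma> * ball_average (\<phi> E) x r) \<longlongrightarrow> \<sigma> * F x) (at_right 0)"
      using avg_in avg_out x by (intro tendsto_mult_left) (auto simp: E_def \<phi>_def)
    have v_L2: "v r \<in> Lp 2 ?M" for r
    proof (rule L2_dominated[OF w, of _ 1])
      have "(\<lambda>y. (indicator (A r) y - indicator B y) * w y) \<in> borel_measurable ?M"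
        using A[of r] B Lp_measurable[OF w] by measurable
      thus "v r \<in> borel_measurable ?M" by (simp add: v_def[abs_def])
      show "\<bar>v r y\<bar> \<le> \<bar>1 * w y\<bar>" for y by (simp add: v_def indicator_def)
    qed
    have remainder: "((\<lambda>r. (norm (S (v r)))\<^sup>2 / b r) \<longlongrightarrow> 0) (at_right 0)"
    proof (rule norm_S_localized_small[OF _ SS_bounded_linear _ bpos])
      show "(b \<longlongrightarrow> 0) (at_right 0)" unfolding b_def by (rule measure_ball_tendsto_0)
      show "ball x r \<inter> \<Omega> \<in> sets ?M" for r using ball_Omega by (simp add: sets_M)
      show "eventually (\<lambda>r. measure ?M (ball x r \<inter> \<Omega>) \<le> b r) (at_right 0)"
      proof (intro always_eventually allI)
        fix r
        have "measure ?M (ball x r \<inter> \<Omega>) = measure lebesgue (ball x r \<inter> \<Omega>)"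
          using Omega_meas by (intro measure_restrict_space) auto
        also have "\<dots> \<le> b r" unfolding b_def
          using ball_Omega by (intro measure_mono_fmeasurable) auto
        finally show "measure ?M (ball x r \<inter> \<Omega>) \<le> b r" .
      qed
      show "v r y = 0" if "y \<notin> ball x r \<inter> \<Omega>" for r y
        using that diff[of y r] B_subset sets_M[of "A r"] A[of r]
        by (cases "y \<in> \<Omega>") (auto simp: v_def indicator_def)
      show "eventually (\<lambda>r. (\<integral>y. (v r y)\<^sup>2 \<partial>?M) \<le> (\<bar>W x\<bar> + 1) * b r) (at_right 0)"
        using eventually_integral_ball_le[OF avg_W]
      proof eventually_elim
        case (elim r)
        have "(\<integral>y. (v r y)\<^sup>2 \<partial>?M) \<le> (\<integral>y. indicator (ball x r) y * W y \<partial>lebesgue)"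
          unfolding integralM
        proof (rule integral_mono)
          show "integrable lebesgue (\<lambda>y. indicator \<Omega> y * (v r y)\<^sup>2)"
            using v_L2[of r] by (simp add: mem_L2_iff intM)
          show "integrable lebesgue (\<lambda>y. indicator (ball x r) y * W y)"
            using integrable_mult_indicator[OF _ W_int, of "ball x r"] by simp
          fix y
          show "indicator \<Omega> y * (v r y)\<^sup>2 \<le> indicator (ball x r) y * W y"
            using diff[of y r] by (cases "y \<in> \<Omega>") (auto simp: v_def W_def \<sigma>_def indicator_def)
        qed
        thus ?case using elim by (simp add: b_def)
      qed
    qed (use v_L2 q_gt in auto)
    have Q_lim: "(Q \<longlongrightarrow> \<sigma> * F x) (at_right 0)"
    proof (rule tendsto_sandwich[OF _ _ avg])
      show "((\<lambda>r. \<sigma> * ball_average (\<phi> E) x r + 1 / 2 * ((norm (S (v r)))\<^sup>2 / b r)) \<longlongrightarrow> \<sigma> * F x) (at_right 0)"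
        using tendsto_add[OF avg tendsto_mult_left[OF remainder, of "1/2"]] by simp
      show "eventually (\<lambda>r. \<sigma> * ball_average (\<phi> E) x r \<le> Q r) (at_right 0)"
        using bpos
      proof eventually_elim
        case (elim r)
        show ?case using divide_right_mono[OF lower[OF A[of r]], of "b r"] elim
          by (simp add: Q_def first_order ball_average_def b_def)
      qed
      show "eventually (\<lambda>r. Q r \<le> \<sigma> * ball_average (\<phi> E) x r + 1 / 2 * ((norm (S (v r)))\<^sup>2 / b r)) (at_right 0)"
        using bpos
      proof eventually_elim
        case (elim r)
        show ?case using divide_right_mono[OF upper[OF A[of r]], of "b r"] elim
          by (simp add: Q_def first_order ball_average_def b_def add_divide_distrib flip: v_def)
      qed
    qed
    have quot: "eventually (\<lambda>r. DJ_quotient \<Omega> S y\<^sub>d g \<beta> B x r = ereal (Q r)) (at_right 0)"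
      using bpos
    proof eventually_elim
      case (elim r)
      have "DJ_quotient \<Omega> S y\<^sub>d g \<beta> B x r = (min_cost (A r) - min_cost B) / ereal (b r)"
        by (simp add: DJ_quotient_def J A_def b_def)
      thus ?case using elim by (simp add: j[OF A] j[OF B] Q_def)
    qed
    have "((\<lambda>r. ereal (Q r)) \<longlongrightarrow> ereal (\<sigma> * F x)) (at_right 0)"
      using Q_lim by (rule tendsto_ereal)
    hence lim: "(DJ_quotient \<Omega> S y\<^sub>d g \<beta> B x \<longlongrightarrow> ereal (\<sigma> * F x)) (at_right 0)"
      using tendsto_cong[OF quot] by blast
    have "eventually (\<lambda>r. 0 \<le> Q r) (at_right 0)"
      using bpos
    proof eventually_elim
      case (elim r)
      have "A r \<subseteq> \<Omega>" "A r \<in> sets lebesgue" using A[of r] by (simp_all add: sets_M)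
      from B_optimal[OF this] have "j B \<le> j (A r)" by (simp add: J j A B)
      thus ?case using elim by (simp add: Q_def)
    qed
    hence "0 \<le> \<sigma> * F x" by (intro tendsto_lowerbound[OF Q_lim]) auto
    moreover have "DJ \<Omega> S y\<^sub>d g \<beta> B x = ereal (\<sigma> * F x)"
      unfolding DJ_def by (rule tendsto_Lim[OF _ lim]) simp
    ultimately show "DJ_exists \<Omega> S y\<^sub>d g \<beta> B x \<and> 0 \<le> DJ \<Omega> S y\<^sub>d g \<beta> B x"
      using lim by (auto simp: DJ_exists_def)
  qed
  moreover have "\<Omega> \<inter> space lebesgue \<in> sets lebesgue" using Omega_meas by simp
  ultimately show ?thesis using AE_restrict_space_iff by blast
qed

end
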